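(* Fix $p \in (0,1)$, and let $G$ be an instance of $G(n,p)$. For any constant $\eta > 0$ there exists a finite positive constant $C = C(\eta,p)$ such that, with probability tending to $1$ as $n\to\infty$, all eigenvectors of the adjacency matrix $A_G$ (normalized to have unit $\ell_2$-norm) have at least $(1/2 - \eta) n$ entries of magnitude at least $\frac{1}{\sqrt{n}\,(\log n)^C}$.
   Context: $G(n,p)$ is the Erdős–Rényi random graph on $n$ vertices in which each pair of vertices is joined by an edge independently with probability $p$. $A_G$ denotes the adjacency matrix of $G$. *)

theory Defs
  imports "HOL-Probability.Product_PMF" "Jordan_Normal_Form.Char_Poly"
begin

text \<open>
  Graphs on the vertex set \<open>{..<n}\<close> are given by their edge sets, each edge being a two-element
  set of vertices.
\<close>

definition all_edges :: "nat \<Rightarrow> nat set set" where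
  "all_edges n = {e. e \<subseteq> {..<n} \<and> card e = 2}"

definition gnp :: "nat \<Rightarrow> real \<Rightarrow> nat set set pmf" where
  "gnp n p = map_pmf (\<lambda>X. {e \<in> all_edges n. X e})
     (Pi_pmf (all_edges n) False (\<lambda>_. bernoulli_pmf p))"

text \<open>
  For \<open>i = j\<close> the set \<open>{i, j}\<close> is a singleton, hence never an edge: the diagonal is zero.
\<close>

definition adjacency_matrix :: "nat \<Rightarrow> nat set set \<Rightarrow> real mat" where
  "adjacency_matrix n E = mat n n (\<lambda>(i, j). if {i, j} \<in> E then 1 else 0)"

end

theory Submission
  imports Defs "HOL-Probability.Probability" "HOL-Real_Asymp.Real_Asymp"
begin

text \<open>
  Write \<open>A = M + p (J - I)\<close>, where \<open>J\<close> is the all-ones matrix and \<open>M\<close> has independent centred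
  entries above the diagonal. With high probability \<open>M\<close> has norm at most \<open>K sqrt n\<close>. An
  eigenvector \<open>v\<close> of \<open>A\<close> satisfies \<open>M v = l v + b 1\<close> with scalars \<open>l\<close> and \<open>b\<close>. If
  \<open>\<bar>l\<bar> \<ge> 8 K sqrt n\<close>, then \<open>v\<close> is close to a constant vector and most of its entries are large.
  Otherwise let \<open>Q\<close> be a set of coordinates outside of which \<open>v\<close> has small norm. Restricting the
  equation to the rows outside \<open>Q\<close> shows that the block of \<open>M\<close> with these rows and the columns in
  \<open>Q\<close> sends \<open>v\<close> to within \<open>O(c sqrt n)\<close> of a constant vector, and this survives rounding \<open>v\<close> to a
  lattice of mesh \<open>c / sqrt n\<close>. The rows of this block are independent, so for a fixed lattice point
  the probability of this is at most the small-ball probability of a row to the power \<open>n - card Q\<close>.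

  If \<open>v\<close> is nearly supported on a small set of coordinates, take this set for \<open>Q\<close>: the small-ball
  probability is bounded away from 1 and there are at most \<open>exp (\<delta> n)\<close> lattice points with \<open>\<delta>\<close> small. If \<open>v\<close> is
  spread out, let \<open>Q\<close> be the set of coordinates at which \<open>\<bar>v\<bar>\<close> is large: the small-ball probability is
  \<open>O(c)\<close>, and there are at most \<open>2 ^ n\<close> sets \<open>Q\<close> and \<open>O(1 / c) ^ card Q\<close> lattice points for each. If
  \<open>card Q \<le> (1 / 2 - \<eta>) n\<close>, the union bound is \<open>O(1) ^ n * c powr (2 * \<eta> * n)\<close>, which is exponentially
  small once the constant \<open>c\<close> is.
\<close>

section \<open>Products of Bernoulli variables\<close>

lemma finite_set_Pi_bernoulli:
  "finite A \<Longrightarrow> finite (set_pmf (Pi_pmf A False (\<lambda>_. bernoulli_pmf p)))"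
  by (rule finite_subset[OF set_Pi_pmf_subset']) auto

lemma integrable_Pi_bernoulli [simp]:
  fixes f :: "('a \<Rightarrow> bool) \<Rightarrow> 'b::{banach, second_countable_topology}"
  shows "finite A \<Longrightarrow> integrable (measure_pmf (Pi_pmf A False (\<lambda>_. bernoulli_pmf p))) f"
  by (intro integrable_measure_pmf_finite finite_set_Pi_bernoulli)

text \<open>Finite supports turn the expectations into finite sums, so independence reduces to
  \<open>sum_product\<close>. The field stays general: real values serve exponential moments,
  complex values characteristic functions.\<close>

lemma expectation_pair_pmf_mult:
  fixes f :: "'a \<Rightarrow> 'c::{real_normed_field, banach, second_countable_topology}"
  assumes "finite (set_pmf P)" "finite (set_pmf Q)"
  shows "measure_pmf.expectation (pair_pmf P Q) (\<lambda>z. f (fst z) * g (snd z))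
    = measure_pmf.expectation P f * measure_pmf.expectation Q g"
proof -
  have "measure_pmf.expectation (pair_pmf P Q) (\<lambda>z. f (fst z) * g (snd z))
    = (\<Sum>z\<in>set_pmf P \<times> set_pmf Q. pmf (pair_pmf P Q) z *\<^sub>R (f (fst z) * g (snd z)))"
    using assms by (intro integral_measure_pmf) auto
  also have "\<dots> = (\<Sum>x\<in>set_pmf P. \<Sum>y\<in>set_pmf Q. (pmf P x *\<^sub>R f x) * (pmf Q y *\<^sub>R g y))"
    unfolding sum.cartesian_product by (intro sum.cong) (auto simp: pmf_pair algebra_simps)
  also have "\<dots> = (\<Sum>x\<in>set_pmf P. pmf P x *\<^sub>R f x) * (\<Sum>y\<in>set_pmf Q. pmf Q y *\<^sub>R g y)"
    by (simp add: sum_product)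
  also have "(\<Sum>x\<in>set_pmf P. pmf P x *\<^sub>R f x) = measure_pmf.expectation P f"
    using assms by (intro integral_measure_pmf[symmetric]) auto
  also have "(\<Sum>x\<in>set_pmf Q. pmf Q x *\<^sub>R g x) = measure_pmf.expectation Q g"
    using assms by (intro integral_measure_pmf[symmetric]) auto
  finally show ?thesis .
qed

text \<open>Dependence on the coordinates in \<open>A\<close> alone is encoded as invariance under
  agreement on \<open>A\<close>. This lets the function glued together by
  \<open>Pi_pmf_union\<close> be replaced by either of its two components.\<close>

lemma expectation_Pi_bernoulli_mult:
  fixes f g :: "('a \<Rightarrow> bool) \<Rightarrow> 'c::{real_normed_field, banach, second_countable_topology}"
  assumes fin: "finite A" "finite B" and disj: "A \<inter> B = {}"
    and f: "\<And>x y. (\<And>e. e \<in> A \<Longrightarrow> x e = y e) \<Longrightarrow> f x = f y"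
    and g: "\<And>x y. (\<And>e. e \<in> B \<Longrightarrow> x e = y e) \<Longrightarrow> g x = g y"
  shows "measure_pmf.expectation (Pi_pmf (A \<union> B) False (\<lambda>_. bernoulli_pmf p)) (\<lambda>x. f x * g x)
    = measure_pmf.expectation (Pi_pmf A False (\<lambda>_. bernoulli_pmf p)) f
      * measure_pmf.expectation (Pi_pmf B False (\<lambda>_. bernoulli_pmf p)) g"
proof -
  have "f (\<lambda>e. if e \<in> A then fst z e else snd z e) = f (fst z)"
       "g (\<lambda>e. if e \<in> A then fst z e else snd z e) = g (snd z)" for z
    using disj by (auto intro!: f g)
  then show ?thesis
    unfolding Pi_pmf_union[OF fin disj]
    by (simp add: case_prod_unfold expectation_pair_pmf_mult finite_set_Pi_bernoulli fin)
qed

lemma expectation_Pi_bernoulli_subset: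
  fixes f :: "('a \<Rightarrow> bool) \<Rightarrow> 'c::{banach, second_countable_topology}"
  assumes "finite B" "A \<subseteq> B" and f: "\<And>x y. (\<And>e. e \<in> A \<Longrightarrow> x e = y e) \<Longrightarrow> f x = f y"
  shows "measure_pmf.expectation (Pi_pmf B False (\<lambda>_. bernoulli_pmf p)) f
    = measure_pmf.expectation (Pi_pmf A False (\<lambda>_. bernoulli_pmf p)) f"
proof -
  have "f (\<lambda>e. if e \<in> A then x e else False) = f x" for x
    by (rule f) auto
  then show ?thesis
    unfolding Pi_pmf_subset[OF assms(1,2)] by simp
qed

text \<open>Induction on \<open>I\<close>, splitting off one block at a time. In the main
  application block \<open>i\<close> is a row: the edges that join vertex \<open>i\<close> to a set
  \<open>Q\<close>. Singleton blocks give the coordinatewise product rule.\<close>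

lemma expectation_Pi_bernoulli_prod_blocks:
  fixes f :: "'i \<Rightarrow> ('a \<Rightarrow> bool) \<Rightarrow> 'c::{real_normed_field, banach, second_countable_topology}"
  assumes "finite I" "\<And>i. i \<in> I \<Longrightarrow> finite (B i)" "disjoint_family_on B I"
    and f: "\<And>i x y. i \<in> I \<Longrightarrow> (\<And>e. e \<in> B i \<Longrightarrow> x e = y e) \<Longrightarrow> f i x = f i y"
  shows "measure_pmf.expectation (Pi_pmf (\<Union>i\<in>I. B i) False (\<lambda>_. bernoulli_pmf p)) (\<lambda>x. \<Prod>i\<in>I. f i x)
    = (\<Prod>i\<in>I. measure_pmf.expectation (Pi_pmf (B i) False (\<lambda>_. bernoulli_pmf p)) (f i))"
  using assms
proof (induction I rule: finite_induct)
  case empty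
  then show ?case by simp
next
  case (insert i I)
  have "measure_pmf.expectation (Pi_pmf (B i \<union> (\<Union>i\<in>I. B i)) False (\<lambda>_. bernoulli_pmf p)) (\<lambda>x. f i x * (\<Prod>i\<in>I. f i x))
    = measure_pmf.expectation (Pi_pmf (B i) False (\<lambda>_. bernoulli_pmf p)) (f i)
    * measure_pmf.expectation (Pi_pmf (\<Union>i\<in>I. B i) False (\<lambda>_. bernoulli_pmf p)) (\<lambda>x. \<Prod>i\<in>I. f i x)"
  proof (rule expectation_Pi_bernoulli_mult[where A = "B i" and B = "\<Union>i\<in>I. B i" and f = "f i"
        and g = "\<lambda>x. \<Prod>i\<in>I. f i x"])
    show "B i \<inter> (\<Union>i\<in>I. B i) = {}"
      using insert.prems(2) insert.hyps(2) by (simp add: disjoint_family_on_insert)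
    show "f i x = f i y" if "\<And>e. e \<in> B i \<Longrightarrow> x e = y e" for x y
      by (rule insert.prems(3)) (use that in auto)
    show "(\<Prod>i\<in>I. f i x) = (\<Prod>i\<in>I. f i y)" if "\<And>e. e \<in> (\<Union>i\<in>I. B i) \<Longrightarrow> x e = y e" for x y
      by (rule prod.cong[OF refl], rule insert.prems(3)) (use that in auto)
  qed (use insert.hyps insert.prems(1) in auto)
  also have "measure_pmf.expectation (Pi_pmf (\<Union>i\<in>I. B i) False (\<lambda>_. bernoulli_pmf p)) (\<lambda>x. \<Prod>i\<in>I. f i x)
    = (\<Prod>i\<in>I. measure_pmf.expectation (Pi_pmf (B i) False (\<lambda>_. bernoulli_pmf p)) (f i))"
  proof (rule insert.IH)
    show "f j x = f j y" if "j \<in> I" "\<And>e. e \<in> B j \<Longrightarrow> x e = y e" for j x y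
      by (rule insert.prems(3)) (use that in auto)
    show "disjoint_family_on B I"
      using insert.prems(2) insert.hyps(2) by (simp add: disjoint_family_on_insert)
  qed (use insert.prems(1) in auto)
  finally show ?case using insert.hyps by simp
qed

lemma expectation_Pi_bernoulli_prod:
  fixes f :: "'a \<Rightarrow> bool \<Rightarrow> 'c::{real_normed_field, banach, second_countable_topology}"
  assumes "finite A"
  shows "measure_pmf.expectation (Pi_pmf A False (\<lambda>_. bernoulli_pmf p)) (\<lambda>x. \<Prod>e\<in>A. f e (x e))
    = (\<Prod>e\<in>A. measure_pmf.expectation (bernoulli_pmf p) (f e))"
proof -
  have "measure_pmf.expectation (Pi_pmf (\<Union>e\<in>A. {e}) False (\<lambda>_. bernoulli_pmf p)) (\<lambda>x. \<Prod>e\<in>A. f e (x e))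
    = (\<Prod>e\<in>A. measure_pmf.expectation (Pi_pmf {e} False (\<lambda>_. bernoulli_pmf p)) (\<lambda>x. f e (x e)))"
    using assms by (intro expectation_Pi_bernoulli_prod_blocks) (auto simp: disjoint_family_on_def)
  then show ?thesis by (simp add: Pi_pmf_singleton)
qed

text \<open>This is Hoeffding's lemma, with the exponent \<open>c\<^sup>2 / 8\<close> rounded up to
  \<open>c\<^sup>2\<close>, which is enough for the Chernoff bound on bilinear forms.\<close>

lemma expectation_exp_bernoulli_le:
  fixes c :: real
  assumes p: "0 \<le> p" "p \<le> 1"
  shows "measure_pmf.expectation (bernoulli_pmf p) (\<lambda>b. exp (c * (of_bool b - p))) \<le> exp (c\<^sup>2)"
proof -
  have pos: "p * exp (c * (1 - p)) + (1 - p) * exp (c * (0 - p)) \<le> exp (c\<^sup>2 / 8)"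
    if p: "0 \<le> p" "p \<le> 1" and c: "0 \<le> c" for c p :: real
  proof -
    have "1 \<le> exp c" using c by simp
    then have "0 \<le> p * (exp c - 1)" using p by (intro mult_nonneg_nonneg) auto
    then have gt: "0 < 1 + p * (exp c - 1)" by linarith
    have "p * exp (c * (1 - p)) + (1 - p) * exp (c * (0 - p)) = exp (- c * p) * (1 + p * (exp c - 1))"
      by (simp add: right_diff_distrib exp_diff exp_minus field_simps)
    also have "\<dots> = exp (- c * p + ln (1 + p * (exp c - 1)))"
      using gt by (simp only: exp_add exp_ln)
    also have "\<dots> \<le> exp (c\<^sup>2 / 8)"
      using Hoeffdings_lemma_aux[OF c p(1)] by simp
    finally show ?thesis .
  qed
  have "p * exp (c * (1 - p)) + (1 - p) * exp (c * (0 - p)) \<le> exp (c\<^sup>2 / 8)"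
  proof (cases "0 \<le> c")
    case False
    \<comment> \<open>Negative \<open>c\<close> reduces to \<open>- c\<close> by exchanging success
      and failure, that is, \<open>p\<close> and \<open>1 - p\<close>.\<close>
    have "(1 - p) * exp ((- c) * (1 - (1 - p))) + (1 - (1 - p)) * exp ((- c) * (0 - (1 - p))) \<le> exp ((- c)\<^sup>2 / 8)"
      using p False by (intro pos) auto
    then show ?thesis by (simp add: algebra_simps)
  qed (use pos p in auto)
  also have "\<dots> \<le> exp (c\<^sup>2)" by simp
  finally show ?thesis using p by (simp add: mult.commute)
qed

section \<open>Small-ball estimates\<close>

text \<open>By the half-angle formula \<open>1 - cos s\<close> is twice the square of
  \<open>sin (s / 2)\<close>, and the cubic Taylor remainder keeps \<open>sin x\<close> above
  \<open>3 / 4 * x\<close> for \<open>x\<close> in [0, 1/2].\<close>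

lemma one_minus_cos_ge:
  fixes s :: real
  assumes "\<bar>s\<bar> \<le> 1"
  shows "s\<^sup>2 / 4 \<le> 1 - cos s"
proof -
  define x where "x = \<bar>s\<bar> / 2"
  have x: "0 \<le> x" "x \<le> 1 / 2" using assms by (auto simp: x_def)
  have "\<bar>sin x - x\<bar> \<le> x ^ 3 / 6"
    using Maclaurin_sin_bound[of x 3] x
    by (simp add: eval_nat_numeral sin_coeff_def field_simps)
  then have "x - x ^ 3 / 6 \<le> sin x" by linarith
  moreover have "x ^ 3 \<le> x * (1 / 2)\<^sup>2"
    unfolding power3_eq_cube power2_eq_square
    using x by (simp only: mult.assoc) (intro mult_mono, auto)
  ultimately have "3 / 4 * x \<le> sin x" using x by (simp add: power2_eq_square)
  then have "(3 / 4 * x)\<^sup>2 \<le> (sin x)\<^sup>2" using x by (intro power_mono) auto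
  moreover have "cos s = 1 - 2 * (sin x)\<^sup>2"
    using cos_double_sin[of x] by (simp add: x_def)
  moreover have "s\<^sup>2 = 4 * x\<^sup>2" by (simp add: x_def power_divide)
  moreover have "(3 / 4 * x)\<^sup>2 = 9 / 16 * x\<^sup>2" by (simp add: power_mult_distrib power_divide)
  ultimately show ?thesis using zero_le_power2[of x] by linarith
qed

text \<open>The squared modulus equals \<open>1 - 2 * (p * (1 - p)) * (1 - cos s)\<close>. It
  returns to 1 at multiples of 2 pi, so Gaussian decay can only hold near 0; hence the restriction
  in the second claim.\<close>

lemma norm_char_bernoulli:
  fixes p s :: real
  assumes p: "0 \<le> p" "p \<le> 1"
  shows "norm (measure_pmf.expectation (bernoulli_pmf p) (\<lambda>b. iexp (s * of_bool b))) \<le> 1"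
    and "\<bar>s\<bar> \<le> 1 \<Longrightarrow> norm (measure_pmf.expectation (bernoulli_pmf p) (\<lambda>b. iexp (s * of_bool b)))
      \<le> exp (- (p * (1 - p) / 4) * s\<^sup>2)"
proof -
  define \<phi> where "\<phi> = measure_pmf.expectation (bernoulli_pmf p) (\<lambda>b. iexp (s * of_bool b))"
  have "\<phi> = p *\<^sub>R iexp s + (1 - p) *\<^sub>R 1"
    unfolding \<phi>_def using p by (subst integral_measure_pmf[of UNIV]) (auto simp: UNIV_bool)
  then have re: "Re \<phi> = p * cos s + (1 - p)" and im: "Im \<phi> = p * sin s"
    by (auto simp: Re_exp Im_exp)
  have expand: "(p * C + (1 - p))\<^sup>2 + (p * S)\<^sup>2 = p\<^sup>2 * (S\<^sup>2 + C\<^sup>2) + 2 * (p * (1 - p)) * C + (1 - p)\<^sup>2"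
    for C S :: real
    by (simp add: power2_eq_square algebra_simps)
  have "(norm \<phi>)\<^sup>2 = (p * cos s + (1 - p))\<^sup>2 + (p * sin s)\<^sup>2"
    by (simp add: cmod_power2 re im)
  also have "\<dots> = p\<^sup>2 * ((sin s)\<^sup>2 + (cos s)\<^sup>2) + 2 * (p * (1 - p)) * cos s + (1 - p)\<^sup>2"
    by (rule expand)
  also have "\<dots> = 1 - 2 * (p * (1 - p)) * (1 - cos s)"
    unfolding sin_cos_squared_add by (simp add: power2_eq_square algebra_simps)
  finally have eq: "(norm \<phi>)\<^sup>2 = 1 - 2 * (p * (1 - p)) * (1 - cos s)" .
  have pq: "0 \<le> p * (1 - p)" using p by simp
  then have "0 \<le> 2 * (p * (1 - p)) * (1 - cos s)" using p by (intro mult_nonneg_nonneg) auto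
  with eq have "(norm \<phi>)\<^sup>2 \<le> 1\<^sup>2" by simp
  then show "norm \<phi> \<le> 1" by (rule power2_le_imp_le) simp
  show "norm \<phi> \<le> exp (- (p * (1 - p) / 4) * s\<^sup>2)" if s: "\<bar>s\<bar> \<le> 1"
  proof (rule power2_le_imp_le)
    have "2 * (p * (1 - p)) * (s\<^sup>2 / 4) \<le> 2 * (p * (1 - p)) * (1 - cos s)"
      using pq one_minus_cos_ge[OF s] by (intro mult_left_mono) auto
    then have "(norm \<phi>)\<^sup>2 \<le> 1 + (- (2 * (p * (1 - p)) * (s\<^sup>2 / 4)))"
      unfolding eq by linarith
    also have "\<dots> \<le> exp (- (2 * (p * (1 - p)) * (s\<^sup>2 / 4)))" by (rule exp_ge_add_one_self)
    also have "\<dots> = (exp (- (p * (1 - p) / 4) * s\<^sup>2))\<^sup>2"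
      by (simp add: exp_double[symmetric])
    finally show "(norm \<phi>)\<^sup>2 \<le> (exp (- (p * (1 - p) / 4) * s\<^sup>2))\<^sup>2" .
  qed simp
qed

text \<open>
  \<open>exp (- t\<^sup>2 / 2)\<close> is the characteristic function of a standard Gaussian \<open>g\<close>, so the left-hand
  side is an average over \<open>g\<close> of the characteristic function of \<open>\<Sum>j. u j \<xi>\<^sub>j\<close> at \<open>g / \<epsilon>\<close>, which
  factorises by independence.
\<close>

lemma gaussian_concentration_le:
  fixes u :: "'a \<Rightarrow> real" and p y \<epsilon> \<theta> :: real
  assumes p: "0 \<le> p" "p \<le> 1" and fin: "finite Q" and pos: "0 < \<epsilon>" "0 < \<theta>"
    and J: "J \<subseteq> Q" "\<And>j. j \<in> J \<Longrightarrow> \<bar>u j\<bar> \<le> \<theta>"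
  shows "measure_pmf.expectation (Pi_pmf Q False (\<lambda>_. bernoulli_pmf p))
      (\<lambda>x. exp (- ((\<Sum>j\<in>Q. of_bool (x j) * u j) - y)\<^sup>2 / (2 * \<epsilon>\<^sup>2)))
    \<le> (\<integral>g. (if \<bar>g\<bar> \<le> \<epsilon> / \<theta> then exp (- (p * (1 - p) / 4 * (\<Sum>j\<in>J. (u j)\<^sup>2) / \<epsilon>\<^sup>2) * g\<^sup>2) else 1)
          \<partial>std_normal_distribution)"
proof -
  define P where "P = Pi_pmf Q False (\<lambda>_. bernoulli_pmf p)"
  define S where "S = set_pmf P"
  define X where "X x = (\<Sum>j\<in>Q. of_bool (x j) * u j) - y" for x
  define h where "h g = (if \<bar>g\<bar> \<le> \<epsilon> / \<theta> then exp (- (p * (1 - p) / 4 * (\<Sum>j\<in>J. (u j)\<^sup>2) / \<epsilon>\<^sup>2) * g\<^sup>2) else 1)"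
    for g :: real
  interpret N: real_distribution std_normal_distribution by (rule real_dist_normal_dist)
  have finS: "finite S" unfolding S_def P_def using fin by (rule finite_set_Pi_bernoulli)
  have int: "integrable std_normal_distribution (\<lambda>g. iexp (t * g))" for t
    by (intro N.integrable_iexp) auto
  have E: "measure_pmf.expectation P f = (\<Sum>x\<in>S. pmf P x *\<^sub>R f x)" for f :: "_ \<Rightarrow> 'b::{banach, second_countable_topology}"
    unfolding S_def using finS S_def by (intro integral_measure_pmf) auto
  have "complex_of_real (measure_pmf.expectation P (\<lambda>x. exp (- (X x)\<^sup>2 / (2 * \<epsilon>\<^sup>2))))
    = (\<Sum>x\<in>S. pmf P x *\<^sub>R char std_normal_distribution (X x / \<epsilon>))"
    unfolding E char_std_normal_distribution by (simp add: power_divide scaleR_conv_of_real mult.commute)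
  also have "\<dots> = (\<Sum>x\<in>S. \<integral>g. pmf P x *\<^sub>R iexp (X x / \<epsilon> * g) \<partial>std_normal_distribution)"
    unfolding char_def by simp
  also have "\<dots> = (\<integral>g. (\<Sum>x\<in>S. pmf P x *\<^sub>R iexp (X x / \<epsilon> * g)) \<partial>std_normal_distribution)"
    by (rule Bochner_Integration.integral_sum[symmetric]) (intro integrable_scaleR_right int)
  finally have eq: "complex_of_real (measure_pmf.expectation P (\<lambda>x. exp (- (X x)\<^sup>2 / (2 * \<epsilon>\<^sup>2))))
    = (\<integral>g. (\<Sum>x\<in>S. pmf P x *\<^sub>R iexp (X x / \<epsilon> * g)) \<partial>std_normal_distribution)" .
  have bound: "norm (\<Sum>x\<in>S. pmf P x *\<^sub>R iexp (X x / \<epsilon> * g)) \<le> h g" for g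
  proof -
    have "(\<Sum>x\<in>S. pmf P x *\<^sub>R iexp (X x / \<epsilon> * g)) = measure_pmf.expectation P (\<lambda>x. iexp (X x / \<epsilon> * g))"
      by (simp add: E)
    also have "\<dots> = measure_pmf.expectation P (\<lambda>x. iexp (- y / \<epsilon> * g) * (\<Prod>j\<in>Q. iexp (u j / \<epsilon> * g * of_bool (x j))))"
    proof (rule arg_cong[where f = "measure_pmf.expectation P"], rule ext)
      fix x
      have "X x / \<epsilon> * g = - y / \<epsilon> * g + (\<Sum>j\<in>Q. u j / \<epsilon> * g * of_bool (x j))"
        unfolding X_def diff_divide_distrib left_diff_distrib sum_divide_distrib sum_distrib_right
        by (simp add: mult_ac)
      then have "iexp (X x / \<epsilon> * g) = exp (\<i> * complex_of_real (- y / \<epsilon> * g) + (\<Sum>j\<in>Q. \<i> * complex_of_real (u j / \<epsilon> * g * of_bool (x j))))"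
        by (simp only: of_real_add of_real_sum distrib_left sum_distrib_left)
      then show "iexp (X x / \<epsilon> * g) = iexp (- y / \<epsilon> * g) * (\<Prod>j\<in>Q. iexp (u j / \<epsilon> * g * of_bool (x j)))"
        by (simp only: exp_add exp_sum[OF fin])
    qed
    also have "\<dots> = iexp (- y / \<epsilon> * g) * measure_pmf.expectation P (\<lambda>x. \<Prod>j\<in>Q. iexp (u j / \<epsilon> * g * of_bool (x j)))"
      by simp
    also have "measure_pmf.expectation P (\<lambda>x. \<Prod>j\<in>Q. iexp (u j / \<epsilon> * g * of_bool (x j)))
      = (\<Prod>j\<in>Q. measure_pmf.expectation (bernoulli_pmf p) (\<lambda>b. iexp (u j / \<epsilon> * g * of_bool b)))"
      unfolding P_def by (rule expectation_Pi_bernoulli_prod[OF fin])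
    finally have "norm (\<Sum>x\<in>S. pmf P x *\<^sub>R iexp (X x / \<epsilon> * g))
      = (\<Prod>j\<in>Q. norm (measure_pmf.expectation (bernoulli_pmf p) (\<lambda>b. iexp (u j / \<epsilon> * g * of_bool b))))"
      by (simp add: norm_mult prod_norm)
    \<comment> \<open>For \<open>j \<in> J\<close> and
      \<open>\<bar>g\<bar> \<le> \<epsilon> / \<theta>\<close> the characteristic function is
      evaluated within [-1, 1], where it decays; every other factor is bounded by 1.\<close>
    also have "\<dots> \<le> (\<Prod>j\<in>Q. if j \<in> J \<and> \<bar>g\<bar> \<le> \<epsilon> / \<theta> then exp (- (p * (1 - p) / 4) * (u j / \<epsilon> * g)\<^sup>2) else 1)"
    proof (rule prod_mono, intro conjI norm_ge_zero)
      fix j assume "j \<in> Q"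
      show "norm (measure_pmf.expectation (bernoulli_pmf p) (\<lambda>b. iexp (u j / \<epsilon> * g * of_bool b)))
        \<le> (if j \<in> J \<and> \<bar>g\<bar> \<le> \<epsilon> / \<theta> then exp (- (p * (1 - p) / 4) * (u j / \<epsilon> * g)\<^sup>2) else 1)"
      proof (cases "j \<in> J \<and> \<bar>g\<bar> \<le> \<epsilon> / \<theta>")
        case True
        then have "\<bar>u j\<bar> * \<bar>g\<bar> \<le> \<theta> * (\<epsilon> / \<theta>)"
          using J(2) pos by (intro mult_mono) auto
        then have "\<bar>u j / \<epsilon> * g\<bar> \<le> 1" using pos by (simp add: abs_mult field_simps)
        then show ?thesis unfolding if_P[OF True] by (rule norm_char_bernoulli(2)[OF p])
      qed (simp only: if_False norm_char_bernoulli(1)[OF p])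
    qed
    also have "\<dots> = h g"
    proof (cases "\<bar>g\<bar> \<le> \<epsilon> / \<theta>")
      case True
      have "(\<Prod>j\<in>Q. if j \<in> J \<and> \<bar>g\<bar> \<le> \<epsilon> / \<theta> then exp (- (p * (1 - p) / 4) * (u j / \<epsilon> * g)\<^sup>2) else 1)
        = (\<Prod>j\<in>J. exp (- (p * (1 - p) / 4) * (u j / \<epsilon> * g)\<^sup>2))"
        using True J(1) fin by (intro prod.mono_neutral_cong_right) auto
      also have "\<dots> = exp (\<Sum>j\<in>J. - (p * (1 - p) / 4) * (u j / \<epsilon> * g)\<^sup>2)"
        using finite_subset[OF J(1) fin] by (simp only: exp_sum)
      also have "(\<Sum>j\<in>J. - (p * (1 - p) / 4) * (u j / \<epsilon> * g)\<^sup>2) = - (p * (1 - p) / 4 * (\<Sum>j\<in>J. (u j)\<^sup>2) / \<epsilon>\<^sup>2) * g\<^sup>2"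
        unfolding sum_distrib_left sum_distrib_right sum_divide_distrib sum_negf[symmetric]
        by (intro sum.cong refl) (simp add: power_mult_distrib power_divide)
      finally show ?thesis using True by (simp add: h_def)
    qed (simp add: h_def)
    finally show ?thesis .
  qed
  have inth: "integrable std_normal_distribution h"
  proof (rule N.integrable_const_bound[where B = 1])
    have "0 \<le> p * (1 - p) / 4 * (\<Sum>j\<in>J. (u j)\<^sup>2) / \<epsilon>\<^sup>2 * g\<^sup>2" for g
      using p by (intro mult_nonneg_nonneg divide_nonneg_nonneg sum_nonneg) auto
    then show "AE g in std_normal_distribution. norm (h g) \<le> 1"
      by (auto simp: h_def)
    show "h \<in> borel_measurable std_normal_distribution" unfolding h_def by measurable
  qed
  have "norm (complex_of_real (measure_pmf.expectation P (\<lambda>x. exp (- (X x)\<^sup>2 / (2 * \<epsilon>\<^sup>2)))))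
    \<le> (\<integral>g. norm (\<Sum>x\<in>S. pmf P x *\<^sub>R iexp (X x / \<epsilon> * g)) \<partial>std_normal_distribution)"
    unfolding eq by (rule integral_norm_bound)
  also have "\<dots> \<le> (\<integral>g. h g \<partial>std_normal_distribution)"
    by (intro integral_mono integrable_norm Bochner_Integration.integrable_sum integrable_scaleR_right int inth bound)
  finally have "norm (complex_of_real (measure_pmf.expectation P (\<lambda>x. exp (- (X x)\<^sup>2 / (2 * \<epsilon>\<^sup>2)))))
    \<le> (\<integral>g. h g \<partial>std_normal_distribution)" .
  then show ?thesis unfolding P_def X_def h_def by simp
qed

text \<open>The first summand is the Gaussian integral of the decaying factor: \<epsilon> over the
  standard deviation coming from \<open>J\<close>, up to a constant. The second pays, by Chebyshev,
  for the range \<open>\<bar>g\<bar> > \<epsilon> / \<theta>\<close> in which no decay is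
  available.\<close>

lemma gaussian_concentration_spread:
  fixes u :: "'a \<Rightarrow> real" and p y \<epsilon> \<theta> V :: real
  assumes p: "0 < p" "p < 1" and fin: "finite Q" and pos: "0 < \<epsilon>" "0 < \<theta>" "0 < V"
    and J: "J \<subseteq> Q" "\<And>j. j \<in> J \<Longrightarrow> \<bar>u j\<bar> \<le> \<theta>" and V: "V \<le> (\<Sum>j\<in>J. (u j)\<^sup>2)"
  shows "measure_pmf.expectation (Pi_pmf Q False (\<lambda>_. bernoulli_pmf p))
      (\<lambda>x. exp (- ((\<Sum>j\<in>Q. of_bool (x j) * u j) - y)\<^sup>2 / (2 * \<epsilon>\<^sup>2)))
    \<le> \<epsilon> / sqrt (p * (1 - p) / 2 * V) + \<theta>\<^sup>2 / \<epsilon>\<^sup>2"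
proof -
  define a where "a = p * (1 - p) / 4 * V / \<epsilon>\<^sup>2"
  define W where "W = (\<Sum>j\<in>J. (u j)\<^sup>2)"
  interpret N: real_distribution std_normal_distribution by (rule real_dist_normal_dist)
  have a: "0 < a" unfolding a_def using p pos by simp
  define \<sigma> where "\<sigma> = 1 / sqrt (1 + 2 * a)"
  have \<sigma>: "0 < \<sigma>" "\<sigma>\<^sup>2 = 1 / (1 + 2 * a)" unfolding \<sigma>_def using a by (auto simp: power_divide)
  \<comment> \<open>Up to the factor \<sigma> the product is again a centred normal density, now of
    variance \<open>1 / (1 + 2 * a)\<close>; hence its integral is \<sigma>.\<close>
  have dens: "std_normal_density x * exp (- a * x\<^sup>2) = \<sigma> * normal_density 0 \<sigma> x" for x
  proof -
    have "std_normal_density x * exp (- a * x\<^sup>2) = 1 / sqrt (2 * pi) * exp (- x\<^sup>2 / 2 + - a * x\<^sup>2)"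
      unfolding std_normal_density_def by (simp only: exp_add mult.assoc)
    also have "- x\<^sup>2 / 2 + - a * x\<^sup>2 = - x\<^sup>2 / (2 * \<sigma>\<^sup>2)"
      unfolding \<sigma>(2) by (simp add: field_simps)
    also have "1 / sqrt (2 * pi) * exp (- x\<^sup>2 / (2 * \<sigma>\<^sup>2)) = \<sigma> * normal_density 0 \<sigma> x"
      unfolding normal_density_def using \<sigma>(1) by (simp add: real_sqrt_mult)
    finally show ?thesis .
  qed
  have intg: "(\<integral>g. exp (- a * g\<^sup>2) \<partial>std_normal_distribution) = \<sigma>"
    by (subst integral_density) (use dens \<sigma> in \<open>auto simp: mult_ac\<close>)
  have ig: "integrable std_normal_distribution (\<lambda>g. exp (- a * g\<^sup>2))"
    by (rule N.integrable_const_bound[where B = 1]) (use a in auto)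
  have i2: "integrable std_normal_distribution (\<lambda>g. g\<^sup>2 * (\<theta>\<^sup>2 / \<epsilon>\<^sup>2))"
    using integrable_std_normal_distribution_moment[of 2] by (rule integrable_mult_left[rotated])
  have "measure_pmf.expectation (Pi_pmf Q False (\<lambda>_. bernoulli_pmf p))
      (\<lambda>x. exp (- ((\<Sum>j\<in>Q. of_bool (x j) * u j) - y)\<^sup>2 / (2 * \<epsilon>\<^sup>2)))
    \<le> (\<integral>g. (if \<bar>g\<bar> \<le> \<epsilon> / \<theta> then exp (- (p * (1 - p) / 4 * W / \<epsilon>\<^sup>2) * g\<^sup>2) else 1)
          \<partial>std_normal_distribution)"
    unfolding W_def using assms by (intro gaussian_concentration_le) auto
  \<comment> \<open>Chebyshev in pointwise form: where
    \<open>\<bar>g\<bar> > \<epsilon> / \<theta>\<close>, the added quadratic term is at least 1,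
    and its integral is known because the second moment is 1.\<close>
  also have "\<dots> \<le> (\<integral>g. exp (- a * g\<^sup>2) + g\<^sup>2 * (\<theta>\<^sup>2 / \<epsilon>\<^sup>2) \<partial>std_normal_distribution)"
  proof (rule integral_mono)
    have W: "a \<le> p * (1 - p) / 4 * W / \<epsilon>\<^sup>2"
      unfolding a_def W_def using p V by (intro divide_right_mono mult_left_mono) auto
    show "integrable std_normal_distribution (\<lambda>g. if \<bar>g\<bar> \<le> \<epsilon> / \<theta> then exp (- (p * (1 - p) / 4 * W / \<epsilon>\<^sup>2) * g\<^sup>2) else 1)"
    proof (rule N.integrable_const_bound[where B = 1])
      have "0 \<le> p * (1 - p) / 4 * W / \<epsilon>\<^sup>2 * g\<^sup>2" for g
        using W a by (intro mult_nonneg_nonneg) auto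
      then show "AE g in std_normal_distribution. norm (if \<bar>g\<bar> \<le> \<epsilon> / \<theta> then exp (- (p * (1 - p) / 4 * W / \<epsilon>\<^sup>2) * g\<^sup>2) else 1) \<le> 1"
        by auto
    qed measurable
    show "integrable std_normal_distribution (\<lambda>g. exp (- a * g\<^sup>2) + g\<^sup>2 * (\<theta>\<^sup>2 / \<epsilon>\<^sup>2))"
      by (intro Bochner_Integration.integrable_add ig i2)
    fix g :: real
    show "(if \<bar>g\<bar> \<le> \<epsilon> / \<theta> then exp (- (p * (1 - p) / 4 * W / \<epsilon>\<^sup>2) * g\<^sup>2) else 1) \<le> exp (- a * g\<^sup>2) + g\<^sup>2 * (\<theta>\<^sup>2 / \<epsilon>\<^sup>2)"
    proof (cases "\<bar>g\<bar> \<le> \<epsilon> / \<theta>")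
      case True
      have "a * g\<^sup>2 \<le> p * (1 - p) / 4 * W / \<epsilon>\<^sup>2 * g\<^sup>2" using W by (rule mult_right_mono) simp
      then have "exp (- (p * (1 - p) / 4 * W / \<epsilon>\<^sup>2) * g\<^sup>2) \<le> exp (- a * g\<^sup>2)" by simp
      also have "\<dots> \<le> exp (- a * g\<^sup>2) + g\<^sup>2 * (\<theta>\<^sup>2 / \<epsilon>\<^sup>2)" by simp
      finally show ?thesis using True by simp
    next
      case False
      then have "(\<epsilon> / \<theta>)\<^sup>2 \<le> \<bar>g\<bar>\<^sup>2" using pos by (intro power_mono) auto
      then have "1 \<le> g\<^sup>2 * (\<theta>\<^sup>2 / \<epsilon>\<^sup>2)" using pos by (simp add: field_simps)
      then show ?thesis using False by (simp add: add_increasing)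
    qed
  qed
  also have "\<dots> = \<sigma> + \<theta>\<^sup>2 / \<epsilon>\<^sup>2"
  proof -
    have "(\<integral>g. g\<^sup>2 \<partial>std_normal_distribution) = 1"
      using std_normal_distribution_even_moments(1)[of 1] by (simp add: fact_numeral)
    then have "(\<integral>g. g\<^sup>2 * (\<theta>\<^sup>2 / \<epsilon>\<^sup>2) \<partial>std_normal_distribution) = \<theta>\<^sup>2 / \<epsilon>\<^sup>2" by simp
    then show ?thesis using Bochner_Integration.integral_add[OF ig i2] intg by simp
  qed
  also have "\<sigma> \<le> \<epsilon> / sqrt (p * (1 - p) / 2 * V)"
  proof -
    have "\<sigma> \<le> 1 / sqrt (2 * a)" unfolding \<sigma>_def using a by (intro divide_left_mono) auto
    also have "2 * a = (p * (1 - p) / 2 * V) / \<epsilon>\<^sup>2" by (simp add: a_def)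
    also have "1 / sqrt \<dots> = \<epsilon> / sqrt (p * (1 - p) / 2 * V)" using pos by (simp add: real_sqrt_divide real_sqrt_mult)
    finally show ?thesis .
  qed
  finally show ?thesis by simp
qed

text \<open>Only a bound below 1, uniform in \<open>Q\<close>, \<open>u\<close> and
  \<open>y\<close>, is wanted. With \<epsilon> = \<theta> = 1 and \<open>J = Q\<close> the Gaussian
  average decreases in the sum of squares, so it is largest at \<open>V\<close>; there it is
  strictly below 1 because the integrand is below 1 on [1/2, 1].\<close>

lemma gaussian_concentration_sparse:
  fixes p V :: real
  assumes p: "0 < p" "p < 1" and V: "0 < V"
  shows "\<exists>G. 0 < G \<and> G < 1 \<and> (\<forall>(Q::'a set) (u::'a \<Rightarrow> real) y. finite Q \<longrightarrow> (\<forall>j\<in>Q. \<bar>u j\<bar> \<le> 1) \<longrightarrow> V \<le> (\<Sum>j\<in>Q. (u j)\<^sup>2)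
    \<longrightarrow> measure_pmf.expectation (Pi_pmf Q False (\<lambda>_. bernoulli_pmf p))
      (\<lambda>x. exp (- ((\<Sum>j\<in>Q. of_bool (x j) * u j) - y)\<^sup>2 / 2)) \<le> G)"
proof -
  define a where "a = p * (1 - p) / 4 * V"
  have a: "0 < a" unfolding a_def using p V by simp
  define h where "h b g = (if \<bar>g\<bar> \<le> 1 then exp (- b * g\<^sup>2) else 1)" for b g :: real
  interpret N: real_distribution std_normal_distribution by (rule real_dist_normal_dist)
  have ih: "integrable std_normal_distribution (h b)" if "0 \<le> b" for b
    by (rule N.integrable_const_bound[where B = 1]) (use that in \<open>auto simp: h_def[abs_def]\<close>)
  have "(\<integral>g. h a g \<partial>std_normal_distribution) < (\<integral>g. 1 \<partial>std_normal_distribution)"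
  proof (rule N.integral_less_AE[where A = "{1/2..1}"])
    show "emeasure std_normal_distribution {1/2..1} \<noteq> 0"
    proof
      assume "emeasure std_normal_distribution {1/2..1} = 0"
      then have "AE x in lborel. ennreal (std_normal_density x) * indicator {1/2..1} x = 0"
        by (subst (asm) emeasure_density) (auto simp: nn_integral_0_iff_AE)
      then have "AE x in lborel. x \<notin> {1/2..1::real}"
        by eventually_elim (auto simp: std_normal_density_def split: split_indicator_asm)
      then have "{1/2..1::real} \<in> null_sets lborel"
        by (subst AE_iff_null_sets) auto
      then show False by (simp add: null_sets_def)
    qed
    show "AE g in std_normal_distribution. g \<in> {1/2..1} \<longrightarrow> h a g \<noteq> 1"
      using a by (intro AE_I2) (auto simp: h_def)
    show "AE g in std_normal_distribution. h a g \<le> 1"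
      using a by (intro AE_I2) (auto simp: h_def)
  qed (use ih a in auto)
  then have less: "(\<integral>g. h a g \<partial>std_normal_distribution) < 1" using N.prob_space by simp
  \<comment> \<open>The lower cap \<open>1 / 2\<close> makes \<open>G\<close> positive at once, so
    that \<open>- ln G\<close> can serve as an exponential rate.\<close>
  define G where "G = max (1 / 2) (\<integral>g. h a g \<partial>std_normal_distribution)"
  show ?thesis
  proof (intro exI[of _ G] conjI allI impI)
    show "0 < G" "G < 1" using less by (auto simp: G_def)
    fix Q :: "'a set" and u :: "'a \<Rightarrow> real" and y :: real
    assume Q: "finite Q" "\<forall>j\<in>Q. \<bar>u j\<bar> \<le> 1" "V \<le> (\<Sum>j\<in>Q. (u j)\<^sup>2)"
    define b where "b = p * (1 - p) / 4 * (\<Sum>j\<in>Q. (u j)\<^sup>2)"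
    have ab: "a \<le> b" unfolding a_def b_def using p Q by (intro mult_left_mono) auto
    have "measure_pmf.expectation (Pi_pmf Q False (\<lambda>_. bernoulli_pmf p))
      (\<lambda>x. exp (- ((\<Sum>j\<in>Q. of_bool (x j) * u j) - y)\<^sup>2 / 2)) \<le> (\<integral>g. h b g \<partial>std_normal_distribution)"
      using gaussian_concentration_le[of p Q 1 1 Q u y] p Q unfolding h_def b_def by (simp cong: if_cong)
    also have "\<dots> \<le> (\<integral>g. h a g \<partial>std_normal_distribution)"
    proof (rule integral_mono)
      show "h b g \<le> h a g" for g
        using mult_right_mono[OF ab, of "g\<^sup>2"] by (auto simp: h_def)
    qed (use ih a ab in auto)
    also have "\<dots> \<le> G" by (simp add: G_def)
    finally show "measure_pmf.expectation (Pi_pmf Q False (\<lambda>_. bernoulli_pmf p))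
      (\<lambda>x. exp (- ((\<Sum>j\<in>Q. of_bool (x j) * u j) - y)\<^sup>2 / 2)) \<le> G" .
  qed
qed

section \<open>Independent rows and counting lattice points\<close>

abbreviation edge_pmf :: "nat \<Rightarrow> real \<Rightarrow> (nat set \<Rightarrow> bool) pmf" where
  "edge_pmf n p \<equiv> Pi_pmf (all_edges n) False (\<lambda>_. bernoulli_pmf p)"

text \<open>The centred adjacency matrix. Its diagonal is 0 instead of \<open>- p\<close>, so every
  entry has mean zero; the difference is a multiple of the identity and merely shifts eigenvalues by
  \<open>p\<close>.\<close>

definition noise :: "real \<Rightarrow> (nat set \<Rightarrow> bool) \<Rightarrow> nat \<Rightarrow> nat \<Rightarrow> real" where
  "noise p X i j = (if i = j then 0 else of_bool (X {i, j}) - p)"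

lemma finite_all_edges [simp]: "finite (all_edges n)"
  by (rule finite_subset[of _ "Pow {..<n}"]) (auto simp: all_edges_def)

lemma pair_in_all_edges: "i < n \<Longrightarrow> j < n \<Longrightarrow> i \<noteq> j \<Longrightarrow> {i, j} \<in> all_edges n"
  by (auto simp: all_edges_def)

text \<open>Markov's inequality for the exponential of minus the sum of squares, which is a product
  over rows. The matrix is symmetric, but rows outside \<open>Q\<close> and columns inside
  \<open>Q\<close> meet in pairwise distinct edges, so these rows are independent and the
  expectation factorises.\<close>

lemma noise_rows_small_ball:
  fixes u :: "nat \<Rightarrow> real" and p b t \<epsilon> G :: real
  assumes Q: "Q \<subseteq> {..<n}" and \<epsilon>: "0 < \<epsilon>"
    and G: "\<And>y. measure_pmf.expectation (Pi_pmf Q False (\<lambda>_. bernoulli_pmf p))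
      (\<lambda>x. exp (- ((\<Sum>j\<in>Q. of_bool (x j) * u j) - y)\<^sup>2 / (2 * \<epsilon>\<^sup>2))) \<le> G"
  shows "measure_pmf.prob (edge_pmf n p)
      {X. (\<Sum>i\<in>{..<n} - Q. ((\<Sum>j\<in>Q. noise p X i j * u j) - b)\<^sup>2) \<le> t}
    \<le> exp (t / (2 * \<epsilon>\<^sup>2)) * G ^ card ({..<n} - Q)"
proof -
  define R where "R = {..<n} - Q"
  define B where "B i = (\<lambda>j. {i, j}) ` Q" for i :: nat
  define f where "f i X = exp (- ((\<Sum>j\<in>Q. noise p X i j * u j) - b)\<^sup>2 / (2 * \<epsilon>\<^sup>2))" for i X
  have fin: "finite Q" "finite R" using Q finite_subset by (auto simp: R_def)
  have neq: "i \<noteq> j" if "i \<in> R" "j \<in> Q" for i j using that by (auto simp: R_def)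
  have depends: "f i x = f i y" if "i \<in> R" "\<And>e. e \<in> B i \<Longrightarrow> x e = y e" for i x y
  proof -
    have "(\<Sum>j\<in>Q. noise p x i j * u j) = (\<Sum>j\<in>Q. noise p y i j * u j)"
      using that by (intro sum.cong refl) (simp add: noise_def B_def)
    then show ?thesis by (simp add: f_def)
  qed
  have factor: "measure_pmf.expectation (Pi_pmf (B i) False (\<lambda>_. bernoulli_pmf p)) (f i) \<le> G"
    if i: "i \<in> R" for i
  proof -
    \<comment> \<open>Naming the edges of row \<open>i\<close> by their endpoints in
      \<open>Q\<close> brings the law of the row into the form of the hypothesis on
      \<open>G\<close>.\<close>
    have "bij_betw (\<lambda>j. {i, j}) Q (B i)"
      unfolding B_def bij_betw_def inj_on_def by (auto simp: doubleton_eq_iff)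
    moreover have "{i, j} \<notin> B i" if "j \<notin> Q" for j
      using that neq[OF i] unfolding B_def by (auto simp: doubleton_eq_iff)
    ultimately have map: "Pi_pmf Q False (\<lambda>_. bernoulli_pmf p)
      = map_pmf (\<lambda>g. g \<circ> (\<lambda>j. {i, j})) (Pi_pmf (B i) False (\<lambda>_. bernoulli_pmf p))"
      by (rule Pi_pmf_bij_betw[OF fin(1)])
    \<comment> \<open>Centring only moves the target by \<open>p\<close> times the sum of the
      \<open>u j\<close>; this is why \<open>G\<close> has to work for every
      \<open>y\<close>.\<close>
    have "(\<Sum>j\<in>Q. noise p X i j * u j) - b = (\<Sum>j\<in>Q. of_bool (X {i, j}) * u j) - (b + p * (\<Sum>j\<in>Q. u j))" for X
    proof -
      have "(\<Sum>j\<in>Q. noise p X i j * u j) = (\<Sum>j\<in>Q. of_bool (X {i, j}) * u j - p * u j)"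
        using neq[OF i] by (intro sum.cong refl) (simp add: noise_def left_diff_distrib)
      then show ?thesis by (simp add: sum_subtractf sum_distrib_left del: sum_mult_of_bool_eq sum_of_bool_mult_eq)
    qed
    then have "measure_pmf.expectation (Pi_pmf (B i) False (\<lambda>_. bernoulli_pmf p)) (f i)
      = measure_pmf.expectation (Pi_pmf Q False (\<lambda>_. bernoulli_pmf p))
      (\<lambda>x. exp (- ((\<Sum>j\<in>Q. of_bool (x j) * u j) - (b + p * (\<Sum>j\<in>Q. u j)))\<^sup>2 / (2 * \<epsilon>\<^sup>2)))"
      unfolding map f_def integral_map_pmf o_def by (simp only:)
    also have "\<dots> \<le> G" by (rule G)
    finally show ?thesis .
  qed
  have "measure_pmf.prob (edge_pmf n p) {X. (\<Sum>i\<in>R. ((\<Sum>j\<in>Q. noise p X i j * u j) - b)\<^sup>2) \<le> t}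
    = measure_pmf.expectation (edge_pmf n p) (indicator {X. (\<Sum>i\<in>R. ((\<Sum>j\<in>Q. noise p X i j * u j) - b)\<^sup>2) \<le> t})"
    by simp
  also have "\<dots> \<le> measure_pmf.expectation (edge_pmf n p) (\<lambda>X. exp (t / (2 * \<epsilon>\<^sup>2)) * (\<Prod>i\<in>R. f i X))"
  proof (rule integral_mono)
    fix X
    define s where "s = (\<Sum>i\<in>R. ((\<Sum>j\<in>Q. noise p X i j * u j) - b)\<^sup>2)"
    have "exp (t / (2 * \<epsilon>\<^sup>2)) * (\<Prod>i\<in>R. f i X) = exp (t / (2 * \<epsilon>\<^sup>2) + (\<Sum>i\<in>R. - ((\<Sum>j\<in>Q. noise p X i j * u j) - b)\<^sup>2 / (2 * \<epsilon>\<^sup>2)))"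
      unfolding f_def using fin by (simp only: exp_add exp_sum)
    also have "\<dots> = exp ((t - s) / (2 * \<epsilon>\<^sup>2))"
      by (simp add: s_def diff_divide_distrib sum_divide_distrib sum_negf)
    finally have eq: "exp (t / (2 * \<epsilon>\<^sup>2)) * (\<Prod>i\<in>R. f i X) = exp ((t - s) / (2 * \<epsilon>\<^sup>2))" .
    show "indicator {X. (\<Sum>i\<in>R. ((\<Sum>j\<in>Q. noise p X i j * u j) - b)\<^sup>2) \<le> t} X \<le> exp (t / (2 * \<epsilon>\<^sup>2)) * (\<Prod>i\<in>R. f i X)"
      unfolding eq using \<epsilon> by (auto simp: s_def[symmetric] indicator_def)
  qed auto
  also have "\<dots> = exp (t / (2 * \<epsilon>\<^sup>2)) * measure_pmf.expectation (edge_pmf n p) (\<lambda>X. \<Prod>i\<in>R. f i X)"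
    by simp
  also have "measure_pmf.expectation (edge_pmf n p) (\<lambda>X. \<Prod>i\<in>R. f i X)
    = measure_pmf.expectation (Pi_pmf (\<Union>i\<in>R. B i) False (\<lambda>_. bernoulli_pmf p)) (\<lambda>X. \<Prod>i\<in>R. f i X)"
  proof (rule expectation_Pi_bernoulli_subset)
    show "(\<Union>i\<in>R. B i) \<subseteq> all_edges n"
      using Q neq by (auto simp: R_def B_def intro!: pair_in_all_edges)
    show "(\<Prod>i\<in>R. f i x) = (\<Prod>i\<in>R. f i y)" if "\<And>e. e \<in> (\<Union>i\<in>R. B i) \<Longrightarrow> x e = y e" for x y
      by (rule prod.cong[OF refl], rule depends) (use that in auto)
  qed simp
  also have "\<dots> = (\<Prod>i\<in>R. measure_pmf.expectation (Pi_pmf (B i) False (\<lambda>_. bernoulli_pmf p)) (f i))"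
  proof (rule expectation_Pi_bernoulli_prod_blocks)
    show "disjoint_family_on B R"
      unfolding disjoint_family_on_def
    proof (intro ballI impI equals0I)
      \<comment> \<open>An edge common to two different rows would have \<open>i = j'\<close>,
        although \<open>i\<close> lies outside \<open>Q\<close> and \<open>j'\<close>
        inside.\<close>
      fix i i' e assume i: "i \<in> R" "i' \<in> R" "i \<noteq> i'" and "e \<in> B i \<inter> B i'"
      then obtain j j' where "j \<in> Q" "j' \<in> Q" "{i, j} = {i', j'}" by (auto simp: B_def)
      then show False using i neq by (auto simp: doubleton_eq_iff)
    qed
    show "f i x = f i y" if "i \<in> R" "\<And>e. e \<in> B i \<Longrightarrow> x e = y e" for i x y
      using that by (rule depends)
  qed (simp_all add: fin B_def)
  also have "\<dots> \<le> (\<Prod>i\<in>R. G)"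
    using factor by (intro prod_mono conjI integral_nonneg_AE) (auto simp: f_def)
  finally show ?thesis by (simp add: R_def)
qed

section \<open>Counting lattice points with exponential weights\<close>

text \<open>Every counted point has weight at least 1, and the total weight of the box factorises
  over the coordinates.\<close>

lemma card_lattice_le:
  fixes h :: "'a \<Rightarrow> int \<Rightarrow> real" and H :: "'a \<Rightarrow> real"
  assumes "finite A" "finite Z" and h: "\<And>j k. 0 \<le> h j k" "\<And>j. j \<in> A \<Longrightarrow> (\<Sum>k\<in>Z. h j k) \<le> H j"
    and P: "\<And>z. z \<in> PiE A (\<lambda>_. Z) \<Longrightarrow> P z \<Longrightarrow> 1 \<le> c * (\<Prod>j\<in>A. h j (z j))" and c: "0 \<le> c"
  shows "real (card {z \<in> PiE A (\<lambda>_. Z). P z}) \<le> c * (\<Prod>j\<in>A. H j)"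
proof -
  have fin: "finite (PiE A (\<lambda>_. Z))" using assms by (intro finite_PiE) auto
  have "real (card {z \<in> PiE A (\<lambda>_. Z). P z}) = (\<Sum>z\<in>{z \<in> PiE A (\<lambda>_. Z). P z}. 1)" by simp
  also have "\<dots> \<le> (\<Sum>z\<in>{z \<in> PiE A (\<lambda>_. Z). P z}. c * (\<Prod>j\<in>A. h j (z j)))"
    using P by (intro sum_mono) auto
  also have "\<dots> \<le> (\<Sum>z\<in>PiE A (\<lambda>_. Z). c * (\<Prod>j\<in>A. h j (z j)))"
    using fin h c by (intro sum_mono2) (auto intro!: mult_nonneg_nonneg prod_nonneg)
  also have "\<dots> = c * (\<Prod>j\<in>A. \<Sum>k\<in>Z. h j k)"
    using assms by (subst prod_sum_PiE) (auto simp: sum_distrib_left)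
  also have "\<dots> \<le> c * (\<Prod>j\<in>A. H j)"
    using h c by (intro mult_left_mono prod_mono) (auto intro!: sum_nonneg)
  finally show ?thesis .
qed

text \<open>Comparison with the integral of the exponential. The induction carries the integral over
  [-N, N] instead of its limit \<open>2 / s\<close>, because its increase pays for the two new
  terms.\<close>

lemma sum_exp_abs_int_le:
  fixes s :: real
  assumes s: "0 < s"
  shows "(\<Sum>k\<in>{- int N..int N}. exp (- s * \<bar>real_of_int k\<bar>)) \<le> 1 + 2 / s"
proof -
  have "(\<Sum>k\<in>{- int N..int N}. exp (- s * \<bar>real_of_int k\<bar>)) \<le> 1 + 2 * (1 - exp (- s * N)) / s"
  proof (induction N)
    case (Suc N)
    have "{- int (Suc N)..int (Suc N)} = insert (int (Suc N)) (insert (- int (Suc N)) {- int N..int N})"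
      by auto
    then have "(\<Sum>k\<in>{- int (Suc N)..int (Suc N)}. exp (- s * \<bar>real_of_int k\<bar>))
      = 2 * exp (- s * Suc N) + (\<Sum>k\<in>{- int N..int N}. exp (- s * \<bar>real_of_int k\<bar>))"
      by simp
    also have "\<dots> \<le> 2 * exp (- s * Suc N) + (1 + 2 * (1 - exp (- s * N)) / s)" using Suc by simp
    also have "\<dots> \<le> 1 + 2 * (1 - exp (- s * Suc N)) / s"
    proof -
      have "s * exp (- s * Suc N) \<le> (exp s - 1) * exp (- s * Suc N)"
        using exp_ge_add_one_self[of s] by (intro mult_right_mono) (linarith, simp)
      also have "\<dots> = exp (- s * N) - exp (- s * Suc N)"
        by (simp add: left_diff_distrib mult_exp_exp algebra_simps)
      finally have "2 * exp (- s * Suc N) \<le> 2 * (exp (- s * N) - exp (- s * Suc N)) / s"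
        using s by (simp add: field_simps)
      then show ?thesis by (simp add: diff_divide_distrib right_diff_distrib)
    qed
    finally show ?case .
  qed simp
  also have "\<dots> \<le> 1 + 2 / s" using s by (simp add: divide_right_mono)
  finally show ?thesis .
qed

text \<open>The weight of \<open>k\<close> is \<open>exp (- s * \<bar>k\<bar>)\<close>. The
  parameter \<open>s\<close> is matched to the typical size of the coordinates: 1 for the norm
  bound, the mesh \<open>c\<close> for spread vectors.\<close>

lemma card_lattice_l1_le:
  fixes s B :: real
  assumes "finite A" and s: "0 < s" and P: "\<And>z. z \<in> PiE A (\<lambda>_. {- int N..int N}) \<Longrightarrow> P z \<Longrightarrow> (\<Sum>j\<in>A. \<bar>real_of_int (z j)\<bar>) \<le> B"
  shows "real (card {z \<in> PiE A (\<lambda>_. {- int N..int N}). P z}) \<le> exp (s * B) * (1 + 2 / s) ^ card A"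
proof -
  have "real (card {z \<in> PiE A (\<lambda>_. {- int N..int N}). P z}) \<le> exp (s * B) * (\<Prod>j\<in>A. 1 + 2 / s)"
  proof (rule card_lattice_le)
    show "(\<Sum>k\<in>{- int N..int N}. exp (- s * \<bar>real_of_int k\<bar>)) \<le> 1 + 2 / s" by (rule sum_exp_abs_int_le[OF s])
    fix z assume z: "z \<in> PiE A (\<lambda>_. {- int N..int N})" "P z"
    have "exp (s * B) * (\<Prod>j\<in>A. exp (- s * \<bar>real_of_int (z j)\<bar>)) = exp (s * (B - (\<Sum>j\<in>A. \<bar>real_of_int (z j)\<bar>)))"
      by (simp add: exp_sum[OF \<open>finite A\<close>, symmetric] mult_exp_exp right_diff_distrib sum_distrib_left sum_negf)
    also have "1 \<le> \<dots>" using P[OF z] s by simp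
    finally show "1 \<le> exp (s * B) * (\<Prod>j\<in>A. exp (- s * \<bar>real_of_int (z j)\<bar>))" .
  qed (use assms in auto)
  then show ?thesis by simp
qed

text \<open>Cauchy-Schwarz, which turns Euclidean constraints into the l1 constraints that the
  weights measure.\<close>

lemma sum_abs_le_sqrt_card:
  fixes f :: "'a \<Rightarrow> real"
  assumes "finite A" "real (card A) \<le> m" "(\<Sum>j\<in>A. (f j)\<^sup>2) \<le> v"
  shows "(\<Sum>j\<in>A. \<bar>f j\<bar>) \<le> sqrt (m * v)"
proof (rule real_le_rsqrt)
  have "(\<Sum>j\<in>A. \<bar>f j\<bar>)\<^sup>2 \<le> real (card A) * (\<Sum>j\<in>A. \<bar>f j\<bar>\<^sup>2)"
    using sum_squared_le_sum_of_squares[of "\<lambda>j. \<bar>f j\<bar>" A]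
    by (simp add: mult.commute)
  also have "\<dots> \<le> m * v" using assms by (intro mult_mono) (auto intro!: sum_nonneg)
  finally show "(\<Sum>j\<in>A. \<bar>f j\<bar>)\<^sup>2 \<le> m * v" .
qed

lemma prob_union_le:
  fixes M :: "'a pmf"
  assumes "finite S" "real (card S) \<le> c" "\<And>z. z \<in> S \<Longrightarrow> measure_pmf.prob M {X. F z X} \<le> e" "0 \<le> e"
  shows "measure_pmf.prob M {X. \<exists>z\<in>S. F z X} \<le> c * e"
proof -
  have "{X. \<exists>z\<in>S. F z X} = (\<Union>z\<in>S. {X. F z X})" by auto
  then have "measure_pmf.prob M {X. \<exists>z\<in>S. F z X} \<le> (\<Sum>z\<in>S. measure_pmf.prob M {X. F z X})"
    using assms(1) by (auto intro!: measure_pmf.finite_measure_subadditive_finite)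
  also have "\<dots> \<le> (\<Sum>z\<in>S. e)" using assms(3) by (rule sum_mono)
  also have "\<dots> \<le> c * e" using assms(2,4) by (simp add: mult_right_mono)
  finally show ?thesis .
qed

section \<open>Bilinear forms of the noise on lattice points\<close>

text \<open>A Chernoff bound with parameter \<open>t\<close>. The positions \<open>(i, j)\<close>
  and \<open>(j, i)\<close> share one random variable, so coefficients are first collected per edge;
  the factor 4 comes from bounding the number of positions of an edge \<open>e\<close> by
  \<open>card (e \<times> e)\<close>.\<close>

lemma noise_bilinear_tail:
  fixes z w :: "nat \<Rightarrow> real" and p t K :: real
  assumes p: "0 \<le> p" "p \<le> 1" and t: "0 < t"
  shows "measure_pmf.prob (edge_pmf n p) {X. K < (\<Sum>i<n. \<Sum>j<n. noise p X i j * z i * w j)}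
    \<le> exp (4 * t\<^sup>2 * ((\<Sum>i<n. (z i)\<^sup>2) * (\<Sum>j<n. (w j)\<^sup>2)) - t * K)"
proof -
  define D where "D = {ij \<in> {..<n} \<times> {..<n}. fst ij \<noteq> snd ij}"
  define g where "g ij = {fst ij, snd ij}" for ij :: "nat \<times> nat"
  define c where "c e = (\<Sum>ij\<in>{ij\<in>D. g ij = e}. z (fst ij) * w (snd ij))" for e
  have finD: "finite D" by (auto simp: D_def)
  have gD: "g ` D \<subseteq> all_edges n" by (auto simp: D_def g_def intro!: pair_in_all_edges)
  have eq: "(\<Sum>i<n. \<Sum>j<n. noise p X i j * z i * w j) = (\<Sum>e\<in>all_edges n. c e * (of_bool (X e) - p))" for X
  proof -
    have "(\<Sum>i<n. \<Sum>j<n. noise p X i j * z i * w j) = (\<Sum>ij\<in>{..<n} \<times> {..<n}. noise p X (fst ij) (snd ij) * z (fst ij) * w (snd ij))"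
      by (simp add: sum.cartesian_product case_prod_unfold)
    also have "\<dots> = (\<Sum>ij\<in>D. noise p X (fst ij) (snd ij) * z (fst ij) * w (snd ij))"
      by (rule sum.mono_neutral_right) (auto simp: D_def noise_def)
    also have "\<dots> = (\<Sum>ij\<in>D. z (fst ij) * w (snd ij) * (of_bool (X (g ij)) - p))"
      by (rule sum.cong) (auto simp: D_def noise_def g_def)
    also have "\<dots> = (\<Sum>e\<in>all_edges n. \<Sum>ij\<in>{ij\<in>D. g ij = e}. z (fst ij) * w (snd ij) * (of_bool (X (g ij)) - p))"
      using gD finD by (intro sum.group[symmetric]) auto
    also have "\<dots> = (\<Sum>e\<in>all_edges n. c e * (of_bool (X e) - p))"
      unfolding c_def sum_distrib_right by (intro sum.cong) auto
    finally show ?thesis .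
  qed
  have csq: "(\<Sum>e\<in>all_edges n. (c e)\<^sup>2) \<le> 4 * ((\<Sum>i<n. (z i)\<^sup>2) * (\<Sum>j<n. (w j)\<^sup>2))"
  proof -
    have "(c e)\<^sup>2 \<le> 4 * (\<Sum>ij\<in>{ij\<in>D. g ij = e}. (z (fst ij) * w (snd ij))\<^sup>2)" if e: "e \<in> all_edges n" for e
    proof -
      have "finite e" "card e = 2" using e finite_subset by (auto simp: all_edges_def)
      have "{ij\<in>D. g ij = e} \<subseteq> e \<times> e" by (auto simp: g_def)
      then have "card {ij\<in>D. g ij = e} \<le> card (e \<times> e)" using \<open>finite e\<close> by (intro card_mono) auto
      then have "real (card {ij\<in>D. g ij = e}) \<le> 4" using \<open>card e = 2\<close> by (simp add: card_cartesian_product)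
      moreover have "(c e)\<^sup>2 \<le> real (card {ij\<in>D. g ij = e}) * (\<Sum>ij\<in>{ij\<in>D. g ij = e}. (z (fst ij) * w (snd ij))\<^sup>2)"
        unfolding c_def by (subst mult.commute) (rule sum_squared_le_sum_of_squares)
      ultimately show ?thesis
        by (meson mult_right_mono order_trans sum_nonneg zero_le_power2)
    qed
    then have "(\<Sum>e\<in>all_edges n. (c e)\<^sup>2) \<le> (\<Sum>e\<in>all_edges n. 4 * (\<Sum>ij\<in>{ij\<in>D. g ij = e}. (z (fst ij) * w (snd ij))\<^sup>2))"
      by (rule sum_mono)
    also have "\<dots> = 4 * (\<Sum>ij\<in>D. (z (fst ij) * w (snd ij))\<^sup>2)"
      unfolding sum_distrib_left[symmetric] using gD finD by (subst sum.group) auto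
    also have "(\<Sum>ij\<in>D. (z (fst ij) * w (snd ij))\<^sup>2) \<le> (\<Sum>ij\<in>{..<n} \<times> {..<n}. (z (fst ij) * w (snd ij))\<^sup>2)"
      by (rule sum_mono2) (auto simp: D_def)
    also have "\<dots> = (\<Sum>i<n. (z i)\<^sup>2) * (\<Sum>j<n. (w j)\<^sup>2)"
      by (simp add: sum_product sum.cartesian_product case_prod_unfold power_mult_distrib)
    finally show ?thesis by simp
  qed
  have "measure_pmf.prob (edge_pmf n p) {X. K < (\<Sum>i<n. \<Sum>j<n. noise p X i j * z i * w j)}
    = measure_pmf.expectation (edge_pmf n p) (indicator {X. K < (\<Sum>e\<in>all_edges n. c e * (of_bool (X e) - p))})"
    by (simp add: eq)
  also have "\<dots> \<le> measure_pmf.expectation (edge_pmf n p) (\<lambda>X. exp (- t * K) * (\<Prod>e\<in>all_edges n. exp ((t * c e) * (of_bool (X e) - p))))"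
  proof (rule integral_mono)
    fix X
    define s where "s = (\<Sum>e\<in>all_edges n. c e * (of_bool (X e) - p))"
    have "exp (- t * K) * (\<Prod>e\<in>all_edges n. exp ((t * c e) * (of_bool (X e) - p))) = exp (- t * K + (\<Sum>e\<in>all_edges n. (t * c e) * (of_bool (X e) - p)))"
      by (simp only: exp_add exp_sum finite_all_edges)
    also have "(\<Sum>e\<in>all_edges n. (t * c e) * (of_bool (X e) - p)) = t * s"
      unfolding s_def sum_distrib_left by (intro sum.cong) (auto simp: mult_ac)
    finally have eq: "exp (- t * K) * (\<Prod>e\<in>all_edges n. exp ((t * c e) * (of_bool (X e) - p))) = exp (- t * K + t * s)" .
    have "K < s \<Longrightarrow> 1 \<le> exp (- t * K + t * s)" using t by simp
    then show "indicator {X. K < (\<Sum>e\<in>all_edges n. c e * (of_bool (X e) - p))} X \<le> exp (- t * K) * (\<Prod>e\<in>all_edges n. exp ((t * c e) * (of_bool (X e) - p)))"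
      unfolding eq by (auto simp: s_def[symmetric] indicator_def)
  qed auto
  also have "\<dots> = exp (- t * K) * (\<Prod>e\<in>all_edges n. measure_pmf.expectation (bernoulli_pmf p) (\<lambda>b. exp ((t * c e) * (of_bool b - p))))"
    by (subst integral_mult_right_zero, subst expectation_Pi_bernoulli_prod) auto
  also have "\<dots> \<le> exp (- t * K) * (\<Prod>e\<in>all_edges n. exp ((t * c e)\<^sup>2))"
    using expectation_exp_bernoulli_le[OF p]
    by (intro mult_left_mono prod_mono conjI integral_nonneg_AE) (auto simp del: integral_bernoulli_pmf)
  also have "\<dots> = exp (- t * K + t\<^sup>2 * (\<Sum>e\<in>all_edges n. (c e)\<^sup>2))"
    by (simp only: exp_add sum_distrib_left exp_sum finite_all_edges power_mult_distrib)
  also have "\<dots> \<le> exp (4 * t\<^sup>2 * ((\<Sum>i<n. (z i)\<^sup>2) * (\<Sum>j<n. (w j)\<^sup>2)) - t * K)"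
    using mult_left_mono[OF csq, of "t\<^sup>2"] by (simp add: algebra_simps)
  finally show ?thesis .
qed

text \<open>Here \<open>v\<close> is the squared radius. The box makes the set finite and, since
  \<open>\<bar>k\<bar> \<le> k\<^sup>2\<close> for integers, contains the whole ball once
  \<open>v \<le> N\<close>. \<open>PiE\<close> fixes the values outside \<open>A\<close>, so that
  cardinalities count restrictions to \<open>A\<close>.\<close>

definition int_ball :: "nat set \<Rightarrow> nat \<Rightarrow> real \<Rightarrow> (nat \<Rightarrow> int) set" where
  "int_ball A N v = {z \<in> PiE A (\<lambda>_. {- int N..int N}). (\<Sum>j\<in>A. (real_of_int (z j))\<^sup>2) \<le> v}"

lemma finite_int_ball: "finite A \<Longrightarrow> finite (int_ball A N v)"
  unfolding int_ball_def by (intro finite_subset[OF _ finite_PiE[of A "\<lambda>_. {- int N..int N}"]]) auto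

text \<open>A ball holds at most \<open>exp (4 * n)\<close> points, so the union over pairs costs
  \<open>exp (8 * n)\<close>, against a tail of \<open>exp (- 16 * n)\<close> for each pair.\<close>

lemma noise_lattice_norm_tail:
  fixes p :: real
  assumes p: "0 \<le> p" "p \<le> 1" and n: "0 < n"
  shows "measure_pmf.prob (edge_pmf n p) {X. \<exists>z\<in>int_ball {..<n} N (4 * real n). \<exists>w\<in>int_ball {..<n} N (4 * real n).
      80 * (real n * sqrt (real n)) < (\<Sum>i<n. \<Sum>j<n. noise p X i j * real_of_int (z i) * real_of_int (w j))} \<le> exp (- real n)"
proof -
  define L where "L = int_ball {..<n} N (4 * real n)"
  have finL: "finite L" by (simp add: L_def finite_int_ball)
  have "real (card L) \<le> exp (1 * (2 * real n)) * (1 + 2 / 1) ^ card {..<n}"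
    unfolding L_def int_ball_def
  proof (rule card_lattice_l1_le)
    fix z :: "nat \<Rightarrow> int" assume "(\<Sum>j<n. (real_of_int (z j))\<^sup>2) \<le> 4 * real n"
    then have "(\<Sum>j<n. \<bar>real_of_int (z j)\<bar>) \<le> sqrt (n * (4 * real n))"
      by (intro sum_abs_le_sqrt_card) auto
    also have "\<dots> = 2 * real n" by (simp add: real_sqrt_mult)
    finally show "(\<Sum>j<n. \<bar>real_of_int (z j)\<bar>) \<le> 2 * real n" .
  qed auto
  also have "\<dots> \<le> exp (2 * real n) * exp 2 ^ n"
    using exp_ge_add_one_self[of 2] by (auto intro!: mult_left_mono power_mono)
  also have "\<dots> = exp (4 * real n)" by (simp add: exp_of_nat_mult[symmetric] mult_exp_exp)
  finally have cardL: "real (card L) \<le> exp (4 * real n)" .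
  have "real (card (L \<times> L)) \<le> exp (4 * real n) * exp (4 * real n)"
    unfolding card_cartesian_product of_nat_mult using cardL by (intro mult_mono) auto
  then have card: "real (card (L \<times> L)) \<le> exp (8 * real n)" by (simp add: mult_exp_exp)
  have tail: "measure_pmf.prob (edge_pmf n p) {X. 80 * (real n * sqrt (real n)) < (\<Sum>i<n. \<Sum>j<n. noise p X i j * real_of_int (z i) * real_of_int (w j))} \<le> exp (- 16 * real n)"
    if zw: "z \<in> L" "w \<in> L" for z w
  proof -
    define a where "a = (\<Sum>i<n. (real_of_int (z i))\<^sup>2)"
    define b where "b = (\<Sum>i<n. (real_of_int (w i))\<^sup>2)"
    have ab: "a \<le> 4 * real n" "b \<le> 4 * real n" "0 \<le> a" "0 \<le> b"
      using zw unfolding a_def b_def L_def int_ball_def by (simp_all add: sum_nonneg)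
    \<comment> \<open>With the Chernoff parameter \<open>1 / sqrt n\<close> the quadratic term is at
      most \<open>64 * n\<close> and the linear term is \<open>80 * n\<close>, which leaves
      \<open>- 16 * n\<close>.\<close>
    have t: "0 < 1 / sqrt (real n)" using n by simp
    have "a * b \<le> (4 * real n) * (4 * real n)"
      using ab by (intro mult_mono) simp_all
    then have "4 * (1 / sqrt (real n))\<^sup>2 * (a * b) \<le> 4 * (1 / sqrt (real n))\<^sup>2 * ((4 * real n) * (4 * real n))"
      by (rule mult_left_mono) simp
    also have "\<dots> = 64 * real n" using n by (simp add: power_divide)
    finally have "4 * (1 / sqrt (real n))\<^sup>2 * (a * b) \<le> 64 * real n" .
    moreover have "1 / sqrt (real n) * (80 * (real n * sqrt (real n))) = 80 * real n" using n by simp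
    ultimately have "exp (4 * (1 / sqrt (real n))\<^sup>2 * (a * b) - 1 / sqrt (real n) * (80 * (real n * sqrt (real n)))) \<le> exp (- 16 * real n)"
      by (simp only: exp_le_cancel_iff)
    then show ?thesis unfolding a_def b_def
      by (rule order_trans[OF noise_bilinear_tail[OF p t]])
  qed
  have "measure_pmf.prob (edge_pmf n p) {X. \<exists>zw\<in>L \<times> L.
      80 * (real n * sqrt (real n)) < (\<Sum>i<n. \<Sum>j<n. noise p X i j * real_of_int (fst zw i) * real_of_int (snd zw j))} \<le> exp (8 * real n) * exp (- 16 * real n)"
    by (rule prob_union_le[OF _ card]) (use tail finL in \<open>simp_all add: mem_Times_iff\<close>)
  also have "\<dots> \<le> exp (- real n)" by (simp add: mult_exp_exp)
  finally show ?thesis unfolding L_def Bex_def split_paired_Ex mem_Times_iff fst_conv snd_conv by (simp add: conj_assoc)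
qed

section \<open>Deterministic estimates for eigenvectors\<close>

text \<open>Rounding towards zero never enlarges an absolute value, so upper bounds on norms and
  entries pass to the rounded vector without loss.\<close>

definition trunc :: "real \<Rightarrow> int" where
  "trunc x = (if 0 \<le> x then \<lfloor>x\<rfloor> else \<lceil>x\<rceil>)"

lemma trunc_bounds:
  "\<bar>real_of_int (trunc x)\<bar> \<le> \<bar>x\<bar>" "\<bar>x - real_of_int (trunc x)\<bar> \<le> 1"
proof -
  have "\<bar>real_of_int (trunc x)\<bar> \<le> \<bar>x\<bar> \<and> \<bar>x - real_of_int (trunc x)\<bar> \<le> 1"
  proof (cases "0 \<le> x")
    case True
    then have "0 \<le> real_of_int \<lfloor>x\<rfloor>" by simp
    moreover have "trunc x = \<lfloor>x\<rfloor>" using True by (simp add: trunc_def)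
    ultimately show ?thesis using True floor_correct[of x] by linarith
  next
    case False
    then have "real_of_int \<lceil>x\<rceil> \<le> 0" by simp
    moreover have "trunc x = \<lceil>x\<rceil>" using False by (simp add: trunc_def)
    ultimately show ?thesis using False ceiling_correct[of x] by linarith
  qed
  then show "\<bar>real_of_int (trunc x)\<bar> \<le> \<bar>x\<bar>" "\<bar>x - real_of_int (trunc x)\<bar> \<le> 1" by auto
qed

lemma trunc_nonzero: "1 \<le> \<bar>x\<bar> \<Longrightarrow> trunc x \<noteq> 0"
  by (cases "0 \<le> x") (simp_all add: trunc_def floor_eq_iff ceiling_eq_iff)

lemma abs_int_le_square: "\<bar>real_of_int k\<bar> \<le> (real_of_int k)\<^sup>2"
proof (cases "k = 0")
  case False
  then have "1 \<le> \<bar>real_of_int k\<bar>" by linarith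
  then have "\<bar>real_of_int k\<bar> * 1 \<le> \<bar>real_of_int k\<bar> * \<bar>real_of_int k\<bar>" by (intro mult_left_mono) auto
  then show ?thesis by (simp add: power2_eq_square abs_mult_self_eq)
qed simp

lemma mem_int_range_if_sum_squares_le:
  fixes z :: "'a \<Rightarrow> int"
  assumes "finite A" "j \<in> A" "(\<Sum>j\<in>A. (real_of_int (z j))\<^sup>2) \<le> v" "v \<le> real N"
  shows "z j \<in> {- int N..int N}"
proof -
  have "\<bar>real_of_int (z j)\<bar> \<le> (real_of_int (z j))\<^sup>2" by (rule abs_int_le_square)
  also have "\<dots> \<le> (\<Sum>j\<in>A. (real_of_int (z j))\<^sup>2)" using assms by (intro member_le_sum) auto
  finally have "\<bar>real_of_int (z j)\<bar> \<le> real N" using assms by linarith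
  then have "\<bar>z j\<bar> \<le> int N" by linarith
  then show ?thesis by (simp add: abs_le_iff)
qed

text \<open>
  Rounding each coordinate up or down according to the sign of its coefficient does not decrease
  a linear form, so the norm of a bilinear form is controlled by lattice points alone, without an
  approximation argument.
\<close>

lemma linear_form_le_int_ball:
  fixes f r :: "nat \<Rightarrow> real"
  assumes "(\<Sum>i<n. (f i)\<^sup>2) \<le> real n"
  shows "\<exists>z\<in>int_ball {..<n} (4 * n) (4 * real n). (\<Sum>i<n. r i * f i) \<le> (\<Sum>i<n. r i * real_of_int (z i))"
proof -
  define z where "z = (\<lambda>i\<in>{..<n}. if 0 \<le> r i then \<lceil>f i\<rceil> else \<lfloor>f i\<rfloor>)"
  have sq: "(real_of_int (z i))\<^sup>2 \<le> 2 * (f i)\<^sup>2 + 2" if "i < n" for i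
  proof -
    have "\<bar>real_of_int (z i) - f i\<bar> \<le> 1"
    proof (cases "0 \<le> r i")
      case True
      then have "z i = \<lceil>f i\<rceil>" using that by (simp add: z_def)
      then show ?thesis using ceiling_correct[of "f i"] by linarith
    next
      case False
      then have "z i = \<lfloor>f i\<rfloor>" using that by (simp add: z_def)
      then show ?thesis using floor_correct[of "f i"] by linarith
    qed
    then have "(real_of_int (z i) - f i)\<^sup>2 \<le> 1" by (simp add: abs_square_le_1)
    \<comment> \<open>The parallelogram identity; with rounding error at most 1 it produces the
      squared radius \<open>4 * n\<close>.\<close>
    moreover have "(real_of_int (z i))\<^sup>2 + (real_of_int (z i) - 2 * f i)\<^sup>2 = 2 * (f i)\<^sup>2 + 2 * (real_of_int (z i) - f i)\<^sup>2"
      by (simp add: power2_eq_square algebra_simps)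
    ultimately show ?thesis using zero_le_power2[of "real_of_int (z i) - 2 * f i"] by linarith
  qed
  have "(\<Sum>i<n. (real_of_int (z i))\<^sup>2) \<le> (\<Sum>i<n. 2 * (f i)\<^sup>2 + 2)" using sq by (intro sum_mono) auto
  also have "\<dots> = 2 * (\<Sum>i<n. (f i)\<^sup>2) + 2 * real n" by (simp add: sum.distrib sum_distrib_left)
  also have "\<dots> \<le> 4 * real n" using assms by simp
  finally have le: "(\<Sum>i<n. (real_of_int (z i))\<^sup>2) \<le> 4 * real n" .
  have "z i \<in> {- int (4 * n)..int (4 * n)}" if "i \<in> {..<n}" for i
    by (rule mem_int_range_if_sum_squares_le[OF _ that le]) auto
  then have "z \<in> int_ball {..<n} (4 * n) (4 * real n)"
    unfolding int_ball_def using le by (simp add: z_def PiE_def Pi_def)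
  moreover have "r i * f i \<le> r i * real_of_int (z i)" if "i < n" for i
    using that by (cases "0 \<le> r i") (auto simp: z_def intro: mult_left_mono mult_left_mono_neg)
  then have "(\<Sum>i<n. r i * f i) \<le> (\<Sum>i<n. r i * real_of_int (z i))" by (intro sum_mono) auto
  ultimately show ?thesis by blast
qed

section \<open>Euclidean norms and the operator norm\<close>

lemma L2_set_scale: "L2_set (\<lambda>i. a * f i) A = \<bar>a\<bar> * L2_set f A"
  unfolding L2_set_def by (simp add: power_mult_distrib sum_distrib_left[symmetric] real_sqrt_mult)

lemma L2_set_power2: "(L2_set f A)\<^sup>2 = (\<Sum>i\<in>A. (f i)\<^sup>2)"
  unfolding L2_set_def by (simp add: sum_nonneg)

lemma L2_set_subset: "finite B \<Longrightarrow> A \<subseteq> B \<Longrightarrow> L2_set f A \<le> L2_set f B"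
  unfolding L2_set_def by (intro real_sqrt_le_mono sum_mono2) auto

lemma L2_set_Un_le: "finite A \<Longrightarrow> finite B \<Longrightarrow> L2_set f (A \<union> B) \<le> L2_set f A + L2_set f B"
proof -
  assume "finite A" "finite B"
  then have "(\<Sum>i\<in>A \<union> B. (f i)\<^sup>2) \<le> (\<Sum>i\<in>A. (f i)\<^sup>2) + (\<Sum>i\<in>B. (f i)\<^sup>2)"
    by (simp add: sum_Un sum_nonneg)
  then have "L2_set f (A \<union> B) \<le> sqrt ((\<Sum>i\<in>A. (f i)\<^sup>2) + (\<Sum>i\<in>B. (f i)\<^sup>2))"
    unfolding L2_set_def by (rule real_sqrt_le_mono)
  also have "\<dots> \<le> L2_set f A + L2_set f B"
    unfolding L2_set_def by (rule sqrt_add_le_add_sqrt) (auto intro: sum_nonneg)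
  finally show ?thesis .
qed

lemma L2_set_bounded_le:
  assumes "finite A" "\<And>i. i \<in> A \<Longrightarrow> \<bar>f i\<bar> \<le> c" "card A \<le> n" "0 \<le> c"
  shows "L2_set f A \<le> sqrt (real n) * c"
proof -
  have "(\<Sum>i\<in>A. (f i)\<^sup>2) \<le> (\<Sum>i\<in>A. c\<^sup>2)"
    using assms by (intro sum_mono) (metis abs_ge_zero power2_abs power_mono)
  also have "\<dots> \<le> real n * c\<^sup>2" using assms by (simp add: mult_right_mono)
  finally have "L2_set f A \<le> sqrt (real n * c\<^sup>2)" unfolding L2_set_def by (rule real_sqrt_le_mono)
  then show ?thesis using assms by (simp add: real_sqrt_mult)
qed

lemma L2_set_const: "L2_set (\<lambda>i. c) A = sqrt (real (card A)) * \<bar>c\<bar>"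
  unfolding L2_set_def by (simp add: real_sqrt_mult)

text \<open>Duality: the norm of the image \<open>y\<close> of \<open>x\<close> is read off from the
  bilinear form at \<open>y\<close> and \<open>x\<close>, both rescaled to Euclidean norm
  \<open>sqrt n\<close>. At that scale rounding to integers changes the norm only by a constant
  factor.\<close>

lemma matrix_norm_le_if_int_ball:
  fixes m :: "nat \<Rightarrow> nat \<Rightarrow> real" and x :: "nat \<Rightarrow> real"
  assumes n: "0 < n" and K: "0 \<le> K"
    and ball: "\<And>z w. z \<in> int_ball {..<n} (4 * n) (4 * real n) \<Longrightarrow> w \<in> int_ball {..<n} (4 * n) (4 * real n) \<Longrightarrow>
      (\<Sum>i<n. \<Sum>j<n. m i j * real_of_int (z i) * real_of_int (w j)) \<le> K * (real n * sqrt (real n))"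
  shows "L2_set (\<lambda>i. \<Sum>j<n. m i j * x j) {..<n} \<le> K * sqrt (real n) * L2_set x {..<n}"
proof -
  have bil: "(\<Sum>i<n. \<Sum>j<n. m i j * f i * g j) \<le> K * (real n * sqrt (real n))"
    if f: "(\<Sum>i<n. (f i)\<^sup>2) \<le> real n" and g: "(\<Sum>i<n. (g i)\<^sup>2) \<le> real n" for f g
  proof -
    \<comment> \<open>The two arguments are rounded one after the other: the form is linear in each
      with the other fixed, and neither rounding decreases it.\<close>
    obtain z where z: "z \<in> int_ball {..<n} (4 * n) (4 * real n)"
      and le1: "(\<Sum>i<n. (\<Sum>j<n. m i j * g j) * f i) \<le> (\<Sum>i<n. (\<Sum>j<n. m i j * g j) * real_of_int (z i))"
      using linear_form_le_int_ball[OF f, of "\<lambda>i. \<Sum>j<n. m i j * g j"] by blast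
    obtain w where w: "w \<in> int_ball {..<n} (4 * n) (4 * real n)"
      and le2: "(\<Sum>j<n. (\<Sum>i<n. m i j * real_of_int (z i)) * g j) \<le> (\<Sum>j<n. (\<Sum>i<n. m i j * real_of_int (z i)) * real_of_int (w j))"
      using linear_form_le_int_ball[OF g, of "\<lambda>j. \<Sum>i<n. m i j * real_of_int (z i)"] by blast
    have "(\<Sum>i<n. \<Sum>j<n. m i j * f i * g j) = (\<Sum>i<n. (\<Sum>j<n. m i j * g j) * f i)"
      unfolding sum_distrib_right by (simp add: mult_ac)
    also note le1
    also have "(\<Sum>i<n. (\<Sum>j<n. m i j * g j) * real_of_int (z i)) = (\<Sum>j<n. (\<Sum>i<n. m i j * real_of_int (z i)) * g j)"
      unfolding sum_distrib_right by (subst sum.swap) (simp add: mult_ac)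
    also note le2
    also have "(\<Sum>j<n. (\<Sum>i<n. m i j * real_of_int (z i)) * real_of_int (w j)) = (\<Sum>i<n. \<Sum>j<n. m i j * real_of_int (z i) * real_of_int (w j))"
      unfolding sum_distrib_right by (rule sum.swap)
    also note ball[OF z w]
    finally show ?thesis .
  qed
  define y where "y i = (\<Sum>j<n. m i j * x j)" for i
  define a where "a = L2_set x {..<n}"
  define b where "b = L2_set y {..<n}"
  have nn: "0 \<le> a" "0 \<le> b" by (simp_all add: a_def b_def L2_set_nonneg)
  show ?thesis
  proof (cases "a = 0 \<or> b = 0")
    case True
    then show ?thesis
    proof
      assume "a = 0"
      then have "\<forall>j<n. x j = 0" unfolding a_def by (simp add: L2_set_eq_0_iff)
      then have "\<forall>i. y i = 0" by (simp add: y_def)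
      then show ?thesis using nn K by (simp add: y_def[symmetric] L2_set_def sum_nonneg)
    next
      assume "b = 0"
      then show ?thesis using nn K by (simp add: y_def[symmetric] b_def[symmetric] a_def[symmetric])
    qed
  next
    case False
    with nn have pos: "0 < a" "0 < b" by auto
    define f where "f i = sqrt (real n) / b * y i" for i
    define g where "g i = sqrt (real n) / a * x i" for i
    have "(\<Sum>i<n. (f i)\<^sup>2) = (L2_set f {..<n})\<^sup>2" "(\<Sum>i<n. (g i)\<^sup>2) = (L2_set g {..<n})\<^sup>2"
      by (simp_all add: L2_set_power2)
    moreover have "L2_set f {..<n} = sqrt (real n)" "L2_set g {..<n} = sqrt (real n)"
      unfolding f_def[abs_def] g_def[abs_def] L2_set_scale using pos by (simp_all add: a_def[symmetric] b_def[symmetric])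
    ultimately have fg: "(\<Sum>i<n. (f i)\<^sup>2) \<le> real n" "(\<Sum>i<n. (g i)\<^sup>2) \<le> real n" by simp_all
    have "(\<Sum>i<n. \<Sum>j<n. m i j * f i * g j) = (\<Sum>i<n. real n / (a * b) * (y i * (\<Sum>j<n. m i j * x j)))"
    proof (rule sum.cong[OF refl])
      fix i
      have "m i j * f i * g j = (sqrt (real n) * sqrt (real n)) / (a * b) * (y i * (m i j * x j))" for j
        unfolding f_def g_def by (simp add: field_simps)
      then show "(\<Sum>j<n. m i j * f i * g j) = real n / (a * b) * (y i * (\<Sum>j<n. m i j * x j))"
        by (simp add: sum_distrib_left)
    qed
    also have "\<dots> = real n / (a * b) * (\<Sum>i<n. (y i)\<^sup>2)"
      by (simp add: y_def[symmetric] sum_distrib_left power2_eq_square)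
    also have "(\<Sum>i<n. (y i)\<^sup>2) = b * b"
      by (simp only: b_def power2_eq_square[symmetric] L2_set_power2)
    also have "real n / (a * b) * (b * b) = real n * (b / a)" using pos by simp
    finally have "real n * (b / a) \<le> K * (real n * sqrt (real n))" using bil[OF fg] by simp
    then have "real n * (b / a) \<le> real n * (K * sqrt (real n))" by (simp only: mult.left_commute)
    then have "b / a \<le> K * sqrt (real n)" using n by (subst (asm) mult_le_cancel_left_pos) auto
    then have "b \<le> K * sqrt (real n) * a" using pos by (simp add: pos_divide_le_eq)
    then show ?thesis by (simp add: a_def b_def y_def[abs_def])
  qed
qed

section \<open>Large eigenvalues, and residuals of rounded eigenvectors\<close>

text \<open>With \<open>c = - b / l\<close> the equation reads \<open>m v = l (v - c 1)\<close>, so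
  \<open>v\<close> is within 1/8 of a constant vector. Each small entry then deviates considerably
  from \<open>c\<close>, and Chebyshev leaves at most \<open>n / 36\<close> of them.\<close>

lemma large_eigenvalue_few_small_entries:
  fixes m :: "nat \<Rightarrow> nat \<Rightarrow> real" and v :: "nat \<Rightarrow> real"
  assumes n: "0 < n" and \<kappa>: "0 < \<kappa>"
    and norm: "L2_set (\<lambda>i. \<Sum>j<n. m i j * v j) {..<n} \<le> \<kappa> * L2_set v {..<n}"
    and unit: "L2_set v {..<n} = 1"
    and eq: "\<And>i. i < n \<Longrightarrow> (\<Sum>j<n. m i j * v j) = l * v i + b"
    and l: "8 * \<kappa> \<le> \<bar>l\<bar>" and \<tau>: "\<tau> * sqrt (real n) \<le> 1 / 8"
  shows "real n / 2 \<le> real (card {i. i < n \<and> \<tau> \<le> \<bar>v i\<bar>})"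
proof -
  have l0: "l \<noteq> 0" using \<kappa> l by auto
  define c where "c = - b / l"
  have "\<bar>l\<bar> * L2_set (\<lambda>i. v i - c) {..<n} = L2_set (\<lambda>i. l * (v i - c)) {..<n}"
    by (simp add: L2_set_scale)
  also have "\<dots> = L2_set (\<lambda>i. \<Sum>j<n. m i j * v j) {..<n}"
    by (rule L2_set_cong[OF refl]) (use eq l0 in \<open>simp add: c_def distrib_left\<close>)
  also have "\<dots> \<le> \<bar>l\<bar> / 8" using norm unit l by simp
  finally have "\<bar>l\<bar> * L2_set (\<lambda>i. v i - c) {..<n} \<le> \<bar>l\<bar> * (1 / 8)" by simp
  then have close: "L2_set (\<lambda>i. v i - c) {..<n} \<le> 1 / 8" using l0 by (subst (asm) mult_le_cancel_left_pos) auto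
  have "L2_set (\<lambda>i. (v i - c) + c) {..<n} \<le> L2_set (\<lambda>i. v i - c) {..<n} + L2_set (\<lambda>i. c) {..<n}"
    by (rule L2_set_triangle_ineq)
  then have c: "7 / 8 \<le> sqrt (real n) * \<bar>c\<bar>" using unit close by (simp add: L2_set_const)
  define S where "S = {i. i < n \<and> \<not> \<tau> \<le> \<bar>v i\<bar>}"
  \<comment> \<open>After scaling by \<open>sqrt n\<close> the constant is at least 7/8 and an entry
    in \<open>S\<close> at most 1/8, which gives the deviation 3/4.\<close>
  have "(\<Sum>i\<in>S. (3 / 4)\<^sup>2) \<le> (\<Sum>i\<in>S. (sqrt (real n) * (v i - c))\<^sup>2)"
  proof (rule sum_mono)
    fix i assume "i \<in> S"
    then have "sqrt (real n) * \<bar>v i\<bar> \<le> sqrt (real n) * \<tau>" by (intro mult_left_mono) (auto simp: S_def)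
    moreover have "sqrt (real n) * \<bar>c\<bar> \<le> sqrt (real n) * (\<bar>v i\<bar> + \<bar>v i - c\<bar>)" by (intro mult_left_mono) auto
    ultimately have "3 / 4 \<le> sqrt (real n) * \<bar>v i - c\<bar>" using c \<tau> by (simp add: algebra_simps)
    then have "(3 / 4)\<^sup>2 \<le> (sqrt (real n) * \<bar>v i - c\<bar>)\<^sup>2" by (intro power_mono) auto
    then show "(3 / 4)\<^sup>2 \<le> (sqrt (real n) * (v i - c))\<^sup>2" by (simp add: power_mult_distrib)
  qed
  also have "\<dots> \<le> (\<Sum>i<n. (sqrt (real n) * (v i - c))\<^sup>2)" by (rule sum_mono2) (auto simp: S_def)
  also have "\<dots> = (sqrt (real n) * L2_set (\<lambda>i. v i - c) {..<n})\<^sup>2"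
    using L2_set_power2[of "\<lambda>i. sqrt (real n) * (v i - c)" "{..<n}"] by (simp add: L2_set_scale)
  also have "\<dots> \<le> (sqrt (real n) * (1 / 8))\<^sup>2" using close by (intro power_mono mult_left_mono) (auto simp: L2_set_nonneg)
  finally have "real (card S) * 9 / 16 \<le> real n / 64" by (simp add: power_mult_distrib power_divide)
  moreover have "card {i. i < n \<and> \<tau> \<le> \<bar>v i\<bar>} + card S = n"
  proof -
    have "card {i. i < n \<and> \<tau> \<le> \<bar>v i\<bar>} + card S = card ({i. i < n \<and> \<tau> \<le> \<bar>v i\<bar>} \<union> S)"
      by (subst card_Un_disjoint) (auto simp: S_def)
    also have "{i. i < n \<and> \<tau> \<le> \<bar>v i\<bar>} \<union> S = {..<n}" by (auto simp: S_def)
    finally show ?thesis by simp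
  qed
  ultimately show ?thesis by linarith
qed

text \<open>On a row outside \<open>Q\<close>, the columns in \<open>Q\<close> contribute
  \<open>l * v i + b\<close> minus the contribution of the remaining columns. The factor 9 is 8 from
  the bound on \<open>l\<close> plus 1 from those columns; the other two terms are the errors of
  replacing \<open>v\<close> by \<open>u\<close> and \<open>b\<close> by \<open>b'\<close>.\<close>

lemma restricted_residual_le:
  fixes m :: "nat \<Rightarrow> nat \<Rightarrow> real" and v u :: "nat \<Rightarrow> real"
  assumes \<kappa>: "0 \<le> \<kappa>"
    and norm: "\<And>x. L2_set (\<lambda>i. \<Sum>j<n. m i j * x j) {..<n} \<le> \<kappa> * L2_set x {..<n}"
    and eq: "\<And>i. i < n \<Longrightarrow> (\<Sum>j<n. m i j * v j) = l * v i + b"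
    and l: "\<bar>l\<bar> \<le> 8 * \<kappa>" and Q: "Q \<subseteq> {..<n}"
  shows "L2_set (\<lambda>i. (\<Sum>j\<in>Q. m i j * u j) - b') ({..<n} - Q)
    \<le> 9 * \<kappa> * L2_set v ({..<n} - Q) + \<kappa> * L2_set (\<lambda>j. v j - u j) Q + sqrt (real n) * \<bar>b - b'\<bar>"
proof -
  define R where "R = {..<n} - Q"
  \<comment> \<open>A submatrix inherits the norm bound: extend the vector by zero and drop
    rows.\<close>
  have part: "L2_set (\<lambda>i. \<Sum>j\<in>S. m i j * x j) R \<le> \<kappa> * L2_set x S" if S: "S \<subseteq> {..<n}" for S x
  proof -
    define y where "y j = (if j \<in> S then x j else 0)" for j
    have "(\<Sum>j\<in>S. m i j * x j) = (\<Sum>j<n. m i j * y j)" for i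
      using S by (intro sum.mono_neutral_cong_left) (auto simp: y_def)
    then have "L2_set (\<lambda>i. \<Sum>j\<in>S. m i j * x j) R = L2_set (\<lambda>i. \<Sum>j<n. m i j * y j) R" by simp
    also have "\<dots> \<le> L2_set (\<lambda>i. \<Sum>j<n. m i j * y j) {..<n}" by (rule L2_set_subset) (auto simp: R_def)
    also have "\<dots> \<le> \<kappa> * L2_set y {..<n}" by (rule norm)
    also have "L2_set y {..<n} = L2_set x S"
      unfolding L2_set_def using S
      by (intro arg_cong[where f = sqrt] sum.mono_neutral_cong_right) (auto simp: y_def)
    finally show ?thesis .
  qed
  define f1 where "f1 i = (\<Sum>j\<in>Q. m i j * (u j - v j))" for i
  define f2 where "f2 i = l * v i" for i
  define f3 where "f3 i = (\<Sum>j\<in>R. m i j * v j)" for i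
  have "(\<Sum>j\<in>Q. m i j * u j) - b' = (f1 i + f2 i) + ((- 1) * f3 i + (b - b'))" if "i \<in> R" for i
  proof -
    have "(\<Sum>j<n. m i j * v j) = (\<Sum>j\<in>Q. m i j * v j) + f3 i"
      unfolding f3_def R_def using Q by (subst sum.subset_diff[OF Q]) auto
    moreover have "f1 i = (\<Sum>j\<in>Q. m i j * u j) - (\<Sum>j\<in>Q. m i j * v j)"
      by (simp add: f1_def right_diff_distrib sum_subtractf)
    ultimately show ?thesis using eq[of i] that by (simp add: f2_def R_def)
  qed
  then have "L2_set (\<lambda>i. (\<Sum>j\<in>Q. m i j * u j) - b') R = L2_set (\<lambda>i. (f1 i + f2 i) + ((- 1) * f3 i + (b - b'))) R"
    by (intro L2_set_cong) auto
  also have "\<dots> \<le> (L2_set f1 R + L2_set f2 R) + (L2_set (\<lambda>i. (- 1) * f3 i) R + L2_set (\<lambda>i. b - b') R)"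
    by (intro order_trans[OF L2_set_triangle_ineq] add_mono L2_set_triangle_ineq)
  also have "L2_set f1 R \<le> \<kappa> * L2_set (\<lambda>j. v j - u j) Q"
  proof -
    have "L2_set (\<lambda>j. u j - v j) Q = L2_set (\<lambda>j. v j - u j) Q"
      unfolding L2_set_def by (simp add: power2_commute)
    then show ?thesis unfolding f1_def[abs_def] using part[OF Q, of "\<lambda>j. u j - v j"] by simp
  qed
  also have "L2_set f2 R \<le> 8 * \<kappa> * L2_set v R"
    unfolding f2_def[abs_def] L2_set_scale using l by (intro mult_right_mono) (auto simp: L2_set_nonneg)
  also have "L2_set (\<lambda>i. (- 1) * f3 i) R \<le> \<kappa> * L2_set v R"
    unfolding L2_set_scale f3_def[abs_def] using part[of R v] by (simp add: R_def)
  also have "L2_set (\<lambda>i. b - b') R \<le> sqrt (real n) * \<bar>b - b'\<bar>"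
    unfolding L2_set_const using card_mono[of "{..<n}" R] by (intro mult_right_mono) (auto simp: R_def)
  finally show ?thesis by (simp add: R_def)
qed

text \<open>
  An integer vector \<open>z\<close> stands for the lattice vector \<open>(c / sqrt n) z\<close>, and \<open>c k\<close> for the rounded
  scalar \<open>b\<close>. Truncation towards zero lets the support of \<open>z\<close> determine \<open>Q\<close> in the sparse case, so
  that no union over \<open>Q\<close> is needed there.
\<close>

definition small_residual :: "(nat \<Rightarrow> nat \<Rightarrow> real) \<Rightarrow> nat \<Rightarrow> real \<Rightarrow> real \<Rightarrow> nat set \<Rightarrow> (nat \<Rightarrow> int) \<Rightarrow> bool" where
  "small_residual m n c \<rho> Q z \<longleftrightarrow> (\<exists>k\<in>{- int (nat \<lceil>n / c\<rceil>)..int (nat \<lceil>n / c\<rceil>)}.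
    (\<Sum>i\<in>{..<n} - Q. ((\<Sum>j\<in>Q. m i j * (c / sqrt (real n) * real_of_int (z j))) - c * real_of_int k)\<^sup>2) \<le> \<rho>\<^sup>2 * real n)"

text \<open>In terms of lattice vectors the norm lies between 1/2 and 1. The bound on the support is
  the number of entries above \<open>\<theta> / sqrt n\<close> that a unit vector can have.\<close>

definition sparse_points :: "nat \<Rightarrow> real \<Rightarrow> real \<Rightarrow> (nat \<Rightarrow> int) set" where
  "sparse_points n \<theta> c = {z \<in> int_ball {..<n} (nat \<lceil>n / c\<^sup>2\<rceil>) (n / c\<^sup>2).
    real (card {j. j < n \<and> z j \<noteq> 0}) \<le> n / \<theta>\<^sup>2 \<and> n / (4 * c\<^sup>2) \<le> (\<Sum>j<n. (real_of_int (z j))\<^sup>2)}"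

text \<open>In terms of lattice vectors the norm is at most 1, and the entries of size at most
  \<open>\<theta> / sqrt n\<close> alone carry norm at least \<open>\<beta> / 2\<close>; they supply
  the small-ball estimate.\<close>

definition spread_points :: "nat \<Rightarrow> real \<Rightarrow> real \<Rightarrow> real \<Rightarrow> nat set \<Rightarrow> (nat \<Rightarrow> int) set" where
  "spread_points n \<theta> \<beta> c Q = {z \<in> int_ball Q (nat \<lceil>n / c\<^sup>2\<rceil>) (n / c\<^sup>2).
    \<beta>\<^sup>2 * n / (4 * c\<^sup>2) \<le> (\<Sum>j\<in>{j\<in>Q. \<bar>real_of_int (z j)\<bar> \<le> \<theta> / c}. (real_of_int (z j))\<^sup>2)}"

text \<open>Each coordinate moves by at most the mesh \<open>c / sqrt n\<close>, hence the whole
  vector by at most \<open>c\<close>. The last claim is the triangle inequality: rounding lowers the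
  norm on any \<open>S\<close> by at most \<open>c\<close>.\<close>

lemma lattice_approximation:
  fixes v :: "nat \<Rightarrow> real" and c :: real
  assumes n: "0 < n" and c: "0 < c" and Q: "Q \<subseteq> {..<n}" and unit: "L2_set v {..<n} = 1"
    and z: "\<And>j. j \<in> Q \<Longrightarrow> z j = trunc (v j * (sqrt (real n) / c))"
  shows "\<And>j. j \<in> Q \<Longrightarrow> \<bar>real_of_int (z j)\<bar> \<le> \<bar>v j\<bar> * (sqrt (real n) / c)"
    and "\<And>S. S \<subseteq> Q \<Longrightarrow> L2_set (\<lambda>j. v j - c / sqrt (real n) * real_of_int (z j)) S \<le> c"
    and "(\<Sum>j\<in>Q. (real_of_int (z j))\<^sup>2) \<le> n / c\<^sup>2"
    and "\<And>S a. S \<subseteq> Q \<Longrightarrow> 0 \<le> a \<Longrightarrow> a + c \<le> L2_set v S \<Longrightarrow> a\<^sup>2 * n / c\<^sup>2 \<le> (\<Sum>j\<in>S. (real_of_int (z j))\<^sup>2)"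
proof -
  define s where "s = sqrt (real n) / c"
  have s: "0 < s" "s\<^sup>2 = n / c\<^sup>2" "c / sqrt (real n) = 1 / s"
    using n c by (auto simp: s_def power_divide)
  have fin: "finite Q" using Q finite_subset by auto
  show b: "\<bar>real_of_int (z j)\<bar> \<le> \<bar>v j\<bar> * (sqrt (real n) / c)" if "j \<in> Q" for j
    using trunc_bounds(1)[of "v j * s"] s z[OF that] by (simp add: s_def[symmetric] abs_mult)
  show d: "L2_set (\<lambda>j. v j - c / sqrt (real n) * real_of_int (z j)) S \<le> c" if S: "S \<subseteq> Q" for S
  proof -
    have "L2_set (\<lambda>j. v j - c / sqrt (real n) * real_of_int (z j)) S \<le> sqrt (real n) * (1 / s)"
    proof (rule L2_set_bounded_le)
      fix j assume "j \<in> S"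
      then have "\<bar>v j * s - real_of_int (z j)\<bar> \<le> 1"
        using trunc_bounds(2)[of "v j * s"] z[of j] S by (auto simp: s_def)
      moreover have "v j - c / sqrt (real n) * real_of_int (z j) = (v j * s - real_of_int (z j)) / s"
        unfolding s(3) using s(1) by (simp add: field_simps)
      ultimately show "\<bar>v j - c / sqrt (real n) * real_of_int (z j)\<bar> \<le> 1 / s"
        using s(1) by (simp add: abs_divide divide_right_mono)
    next
      show "card S \<le> n" using card_mono[of "{..<n}" S] S Q by auto
    qed (use S fin finite_subset s in auto)
    also have "\<dots> = c" using n c by (simp add: s_def)
    finally show ?thesis .
  qed
  have "(\<Sum>j\<in>Q. (real_of_int (z j))\<^sup>2) \<le> (\<Sum>j\<in>Q. (s * v j)\<^sup>2)"
    using b s c by (intro sum_mono abs_le_square_iff[THEN iffD1]) (auto simp: s_def abs_mult mult.commute)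
  also have "\<dots> = s\<^sup>2 * (L2_set v Q)\<^sup>2"
    by (simp add: L2_set_power2 sum_distrib_left power_mult_distrib)
  also have "\<dots> \<le> s\<^sup>2 * 1\<^sup>2"
    using L2_set_subset[of "{..<n}" Q v] unit Q by (intro mult_left_mono power_mono) (auto simp: L2_set_nonneg)
  finally show "(\<Sum>j\<in>Q. (real_of_int (z j))\<^sup>2) \<le> n / c\<^sup>2" by (simp add: s)
  show "a\<^sup>2 * n / c\<^sup>2 \<le> (\<Sum>j\<in>S. (real_of_int (z j))\<^sup>2)" if S: "S \<subseteq> Q" and a: "0 \<le> a" "a + c \<le> L2_set v S" for S a
  proof -
    have "L2_set v S = L2_set (\<lambda>j. (v j - 1 / s * real_of_int (z j)) + 1 / s * real_of_int (z j)) S" by simp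
    also have "\<dots> \<le> c + L2_set (\<lambda>j. 1 / s * real_of_int (z j)) S"
      using d[OF S] unfolding s(3) by (intro order_trans[OF L2_set_triangle_ineq]) auto
    also have "\<dots> = c + 1 / s * L2_set (\<lambda>j. real_of_int (z j)) S" using s by (simp only: L2_set_scale) simp
    finally have "a \<le> 1 / s * L2_set (\<lambda>j. real_of_int (z j)) S" using a by simp
    then have "a * s \<le> L2_set (\<lambda>j. real_of_int (z j)) S" using s by (simp add: field_simps)
    then have "(a * s)\<^sup>2 \<le> (L2_set (\<lambda>j. real_of_int (z j)) S)\<^sup>2" using a s by (intro power_mono) auto
    then show ?thesis by (simp add: L2_set_power2 power_mult_distrib s)
  qed
qed

text \<open>The mesh equals the bound on the norm of \<open>v\<close> outside \<open>Q\<close>, so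
  all three error terms have order \<open>c sqrt n\<close>. The bound on \<open>b\<close> confines
  the rounded scalar to a range of size \<open>O(n / c)\<close>.\<close>

lemma eigenvector_small_residual:
  fixes m :: "nat \<Rightarrow> nat \<Rightarrow> real" and v :: "nat \<Rightarrow> real"
  assumes n: "0 < n" and K: "1 \<le> K" and c: "0 < c" and b: "\<bar>b\<bar> \<le> n"
    and norm: "\<And>x. L2_set (\<lambda>i. \<Sum>j<n. m i j * x j) {..<n} \<le> K * sqrt (real n) * L2_set x {..<n}"
    and unit: "L2_set v {..<n} = 1"
    and eq: "\<And>i. i < n \<Longrightarrow> (\<Sum>j<n. m i j * v j) = l * v i + b"
    and l: "\<bar>l\<bar> \<le> 8 * (K * sqrt (real n))" and Q: "Q \<subseteq> {..<n}" and R: "L2_set v ({..<n} - Q) \<le> c"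
    and z: "\<And>j. j \<in> Q \<Longrightarrow> z j = trunc (v j * (sqrt (real n) / c))"
  shows "small_residual m n c (11 * K * c) Q z"
proof -
  define k where "k = trunc (b / c)"
  have "\<bar>b / c - real_of_int k\<bar> \<le> 1" unfolding k_def by (rule trunc_bounds(2))
  moreover have "b - c * real_of_int k = c * (b / c - real_of_int k)" using c by (simp add: field_simps)
  ultimately have bk: "\<bar>b - c * real_of_int k\<bar> \<le> c" using c by (simp add: abs_mult)
  have "\<bar>real_of_int k\<bar> \<le> \<bar>b / c\<bar>" unfolding k_def by (rule trunc_bounds(1))
  also have "\<dots> \<le> n / c" using b c by (simp add: abs_divide divide_right_mono)
  also have "\<dots> \<le> real (nat \<lceil>n / c\<rceil>)" by (rule real_nat_ceiling_ge)
  finally have "\<bar>k\<bar> \<le> int (nat \<lceil>n / c\<rceil>)" by linarith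
  then have k: "k \<in> {- int (nat \<lceil>n / c\<rceil>)..int (nat \<lceil>n / c\<rceil>)}" by auto
  define u where "u j = c / sqrt (real n) * real_of_int (z j)" for j
  have "L2_set (\<lambda>i. (\<Sum>j\<in>Q. m i j * u j) - c * real_of_int k) ({..<n} - Q)
    \<le> 9 * (K * sqrt (real n)) * L2_set v ({..<n} - Q) + K * sqrt (real n) * L2_set (\<lambda>j. v j - u j) Q + sqrt (real n) * \<bar>b - c * real_of_int k\<bar>"
    by (rule restricted_residual_le[OF _ norm eq l Q]) (use K in auto)
  also have "\<dots> \<le> 9 * (K * sqrt (real n)) * c + K * sqrt (real n) * c + sqrt (real n) * c"
  proof (intro add_mono mult_left_mono)
    show "L2_set (\<lambda>j. v j - u j) Q \<le> c"
      unfolding u_def using lattice_approximation(2)[OF n c Q unit z] by blast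
  qed (use K R bk in auto)
  \<comment> \<open>11 = 9 + 1 + 1, where the rounding of \<open>b\<close> is absorbed by
    \<open>1 \<le> K\<close>.\<close>
  also have "\<dots> \<le> 11 * K * c * sqrt (real n)"
    using mult_right_mono[OF K, of "sqrt (real n) * c"] c by (simp add: algebra_simps)
  finally have "(L2_set (\<lambda>i. (\<Sum>j\<in>Q. m i j * u j) - c * real_of_int k) ({..<n} - Q))\<^sup>2 \<le> (11 * K * c * sqrt (real n))\<^sup>2"
    by (intro power_mono) (auto simp: L2_set_nonneg)
  then have "(\<Sum>i\<in>{..<n} - Q. ((\<Sum>j\<in>Q. m i j * u j) - c * real_of_int k)\<^sup>2) \<le> (11 * K * c)\<^sup>2 * real n"
    by (simp only: L2_set_power2 power_mult_distrib) simp
  then show ?thesis unfolding small_residual_def u_def using k by blast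
qed

lemma int_ballI:
  assumes "finite A" "z \<in> extensional A" "(\<Sum>j\<in>A. (real_of_int (z j))\<^sup>2) \<le> v"
  shows "z \<in> int_ball A (nat \<lceil>v\<rceil>) v"
proof -
  have "z j \<in> {- int (nat \<lceil>v\<rceil>)..int (nat \<lceil>v\<rceil>)}" if "j \<in> A" for j
    by (rule mem_int_range_if_sum_squares_le[OF assms(1) that assms(3) real_nat_ceiling_ge])
  then show ?thesis using assms unfolding int_ball_def PiE_def by auto
qed

text \<open>Three cases: a large eigenvalue; almost all norm on the set \<open>L\<close> of entries
  above \<open>\<theta> / sqrt n\<close>, rounded at mesh \<beta> with \<open>Q = L\<close>;
  otherwise rounding at the finer mesh \<open>c\<close> with \<open>Q = T\<close>, outside of which
  the norm is at most \<open>\<tau> * sqrt n\<close>.\<close>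

lemma eigenvector_large_entries_or_small_residual:
  fixes m :: "nat \<Rightarrow> nat \<Rightarrow> real" and v :: "nat \<Rightarrow> real"
  assumes n: "0 < n" and K: "1 \<le> K" and b: "\<bar>b\<bar> \<le> n"
    and norm: "\<And>x. L2_set (\<lambda>i. \<Sum>j<n. m i j * x j) {..<n} \<le> K * sqrt (real n) * L2_set x {..<n}"
    and unit: "L2_set v {..<n} = 1"
    and eq: "\<And>i. i < n \<Longrightarrow> (\<Sum>j<n. m i j * v j) = l * v i + b"
    and \<beta>: "0 < \<beta>" "\<beta> \<le> 1 / 4" and \<theta>: "1 \<le> \<theta>" and c: "0 < c" "c \<le> \<beta> / 4"
    and \<tau>: "0 \<le> \<tau>" "\<tau> * sqrt (real n) \<le> c"
  defines "T \<equiv> {i. i < n \<and> \<tau> \<le> \<bar>v i\<bar>}"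
  shows "real n / 2 \<le> real (card T)
    \<or> (\<exists>z\<in>sparse_points n \<theta> \<beta>. small_residual m n \<beta> (11 * K * \<beta>) {j. j < n \<and> z j \<noteq> 0} z)
    \<or> (\<exists>z\<in>spread_points n \<theta> \<beta> c T. small_residual m n c (11 * K * c) T z)"
proof (cases "8 * (K * sqrt (real n)) \<le> \<bar>l\<bar>")
  case True
  have "real n / 2 \<le> real (card T)"
    unfolding T_def
    by (rule large_eigenvalue_few_small_entries[OF n _ norm unit eq True]) (use n K \<tau> c \<beta> in auto)
  then show ?thesis by simp
next
  case False
  then have l: "\<bar>l\<bar> \<le> 8 * (K * sqrt (real n))" by simp
  define L where "L = {i. i < n \<and> \<theta> / sqrt (real n) < \<bar>v i\<bar>}"
  have L: "L \<subseteq> {..<n}" and T: "T \<subseteq> {..<n}" by (auto simp: L_def T_def)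
  show ?thesis
  proof (cases "L2_set v ({..<n} - L) \<le> \<beta>")
    case True
    define z where "z = (\<lambda>j\<in>{..<n}. if j \<in> L then trunc (v j * (sqrt (real n) / \<beta>)) else 0)"
    have z: "z j = trunc (v j * (sqrt (real n) / \<beta>))" if "j \<in> L" for j using that L by (auto simp: z_def)
    have z0: "z j = 0" if "j < n" "j \<notin> L" for j using that by (simp add: z_def)
    \<comment> \<open>Entries in \<open>L\<close> exceed one mesh width because \<theta> / \<beta>
      is at least 1; so none is truncated to 0 and the support of \<open>z\<close> recovers
      \<open>L\<close>.\<close>
    have "z j \<noteq> 0" if j: "j \<in> L" for j
    proof -
      have "\<theta> / sqrt (real n) * (sqrt (real n) / \<beta>) \<le> \<bar>v j\<bar> * (sqrt (real n) / \<beta>)"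
        using j \<beta> n by (intro mult_right_mono) (auto simp: L_def)
      then have "\<theta> / \<beta> \<le> \<bar>v j * (sqrt (real n) / \<beta>)\<bar>" using n \<beta> by (simp add: abs_mult)
      moreover have "1 \<le> \<theta> / \<beta>" using \<theta> \<beta> by simp
      ultimately show ?thesis unfolding z[OF j] by (intro trunc_nonzero) linarith
    qed
    then have supp: "{j. j < n \<and> z j \<noteq> 0} = L" using L z0 by auto
    note approx = lattice_approximation[OF n \<beta>(1) L unit z]
    have sumL: "(\<Sum>j<n. (real_of_int (z j))\<^sup>2) = (\<Sum>j\<in>L. (real_of_int (z j))\<^sup>2)"
      using L z0 by (intro sum.mono_neutral_right) auto
    have "real (card L) * (\<theta>\<^sup>2 / n) = (\<Sum>j\<in>L. (\<theta> / sqrt (real n))\<^sup>2)" by (simp add: power_divide)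
    also have "\<dots> \<le> (\<Sum>j\<in>L. (v j)\<^sup>2)"
    proof (rule sum_mono)
      fix j assume "j \<in> L"
      then have "(\<theta> / sqrt (real n))\<^sup>2 \<le> \<bar>v j\<bar>\<^sup>2" using \<theta> by (intro power_mono) (auto simp: L_def)
      then show "(\<theta> / sqrt (real n))\<^sup>2 \<le> (v j)\<^sup>2" by simp
    qed
    also have "\<dots> \<le> (\<Sum>j<n. (v j)\<^sup>2)" using L by (intro sum_mono2) auto
    also have "\<dots> = 1" using L2_set_power2[of v "{..<n}"] unit by simp
    finally have cardL: "real (card L) \<le> n / \<theta>\<^sup>2" using \<theta> n by (simp add: field_simps)
    \<comment> \<open>The norm on \<open>L\<close> is at least \<open>1 - \<beta>\<close>, and
      \<beta> \<le> 1/4 leaves 1/2 even after rounding at mesh \<beta>.\<close>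
    have "1 \<le> L2_set v L + L2_set v ({..<n} - L)"
      using L2_set_Un_le[of L "{..<n} - L" v] L unit finite_subset[OF L] by (simp add: Un_absorb1)
    then have "(1 / 2)\<^sup>2 * n / \<beta>\<^sup>2 \<le> (\<Sum>j\<in>L. (real_of_int (z j))\<^sup>2)"
      using True \<beta> by (intro approx(4)) auto
    then have "real n / (4 * \<beta>\<^sup>2) \<le> (\<Sum>j\<in>L. (real_of_int (z j))\<^sup>2)" by (simp add: power_divide)
    moreover have "z \<in> int_ball {..<n} (nat \<lceil>n / \<beta>\<^sup>2\<rceil>) (n / \<beta>\<^sup>2)"
    proof (rule int_ballI)
      show "z \<in> extensional {..<n}" unfolding z_def by (rule restrict_extensional)
    qed (use approx(3) sumL in auto)
    ultimately have "z \<in> sparse_points n \<theta> \<beta>"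
      unfolding sparse_points_def supp mem_Collect_eq sumL using cardL by blast
    moreover have "small_residual m n \<beta> (11 * K * \<beta>) L z"
      by (rule eigenvector_small_residual[OF n K \<beta>(1) b norm unit eq l L True z])
    ultimately show ?thesis using supp by metis
  next
    case False
    define z where "z = (\<lambda>j\<in>T. trunc (v j * (sqrt (real n) / c)))"
    have z: "z j = trunc (v j * (sqrt (real n) / c))" if "j \<in> T" for j using that by (simp add: z_def)
    note approx = lattice_approximation[OF n c(1) T unit z]
    have "L2_set v ({..<n} - T) \<le> sqrt (real n) * \<tau>"
    proof (rule L2_set_bounded_le)
      show "card ({..<n} - T) \<le> n" using card_mono[of "{..<n}" "{..<n} - T"] by simp
    qed (use \<tau> in \<open>auto simp: T_def\<close>)
    then have R: "L2_set v ({..<n} - T) \<le> c" using \<tau> by (simp add: mult.commute)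
    have "L2_set v ({..<n} - L) \<le> L2_set v ((T - L) \<union> ({..<n} - T))"
      by (rule L2_set_subset) (use finite_subset[OF T] in auto)
    also have "\<dots> \<le> L2_set v (T - L) + L2_set v ({..<n} - T)"
      using finite_subset[OF T] by (intro L2_set_Un_le) auto
    \<comment> \<open>More than \<beta> lies outside \<open>L\<close> and at most \<open>c\<close>
      of it outside \<open>T\<close>; the condition \<open>c \<le> \<beta> / 4\<close> leaves
      \<open>\<beta> / 2\<close> plus the rounding loss \<open>c\<close>.\<close>
    finally have "\<beta> / 2 + c \<le> L2_set v (T - L)" using False R c by simp
    then have "(\<beta> / 2)\<^sup>2 * n / c\<^sup>2 \<le> (\<Sum>j\<in>T - L. (real_of_int (z j))\<^sup>2)"
      using \<beta> by (intro approx(4)) auto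
    also have "\<dots> \<le> (\<Sum>j\<in>{j\<in>T. \<bar>real_of_int (z j)\<bar> \<le> \<theta> / c}. (real_of_int (z j))\<^sup>2)"
    proof (rule sum_mono2)
      show "T - L \<subseteq> {j\<in>T. \<bar>real_of_int (z j)\<bar> \<le> \<theta> / c}"
      proof
        fix j assume j: "j \<in> T - L"
        then have "\<bar>real_of_int (z j)\<bar> \<le> \<bar>v j\<bar> * (sqrt (real n) / c)" using approx(1) by auto
        also have "\<dots> \<le> \<theta> / sqrt (real n) * (sqrt (real n) / c)"
          using j T c by (intro mult_right_mono) (auto simp: L_def)
        also have "\<dots> = \<theta> / c" using n by simp
        finally show "j \<in> {j\<in>T. \<bar>real_of_int (z j)\<bar> \<le> \<theta> / c}" using j by auto
      qed
    qed (use finite_subset[OF T] in auto)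
    finally have "\<beta>\<^sup>2 * n / (4 * c\<^sup>2) \<le> (\<Sum>j\<in>{j\<in>T. \<bar>real_of_int (z j)\<bar> \<le> \<theta> / c}. (real_of_int (z j))\<^sup>2)"
      by (simp add: power_divide)
    moreover have "z \<in> int_ball T (nat \<lceil>n / c\<^sup>2\<rceil>) (n / c\<^sup>2)"
      using approx(3) finite_subset[OF T] by (intro int_ballI) (auto simp: z_def)
    ultimately have "z \<in> spread_points n \<theta> \<beta> c T" unfolding spread_points_def by simp
    moreover have "small_residual m n c (11 * K * c) T z"
      by (rule eigenvector_small_residual[OF n K c(1) b norm unit eq l T R z])
    ultimately show ?thesis by blast
  qed
qed

section \<open>Union bounds\<close>

text \<open>The union over the rounded scalar \<open>k\<close> costs only a factor linear in
  \<open>n\<close>.\<close>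

lemma small_residual_tail:
  fixes p c \<rho> \<epsilon> G :: real and z :: "nat \<Rightarrow> int"
  assumes c: "0 < c" and Q: "Q \<subseteq> {..<n}" and \<epsilon>: "0 < \<epsilon>" and G0: "0 \<le> G"
    and G: "\<And>y. measure_pmf.expectation (Pi_pmf Q False (\<lambda>_. bernoulli_pmf p))
      (\<lambda>x. exp (- ((\<Sum>j\<in>Q. of_bool (x j) * (c / sqrt (real n) * real_of_int (z j))) - y)\<^sup>2 / (2 * \<epsilon>\<^sup>2))) \<le> G"
  shows "measure_pmf.prob (edge_pmf n p) {X. small_residual (noise p X) n c \<rho> Q z}
    \<le> (2 * real n / c + 3) * (exp (\<rho>\<^sup>2 * real n / (2 * \<epsilon>\<^sup>2)) * G ^ card ({..<n} - Q))"
  unfolding small_residual_def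
proof (rule prob_union_le)
  define N where "N = nat \<lceil>n / c\<rceil>"
  have "real N \<le> n / c + 1"
    unfolding N_def using c by (simp add: of_nat_nat)
  then show "real (card {- int N..int N}) \<le> 2 * real n / c + 3" by simp
  show "measure_pmf.prob (edge_pmf n p)
      {X. (\<Sum>i\<in>{..<n} - Q. ((\<Sum>j\<in>Q. noise p X i j * (c / sqrt (real n) * real_of_int (z j))) - c * real_of_int k)\<^sup>2) \<le> \<rho>\<^sup>2 * real n}
    \<le> exp (\<rho>\<^sup>2 * real n / (2 * \<epsilon>\<^sup>2)) * G ^ card ({..<n} - Q)" for k
    by (rule noise_rows_small_ball[OF Q \<epsilon> G])
qed (use G0 in auto)

text \<open>The weight combines a factor \<open>1 / \<theta>\<close> for each nonzero coordinate
  with exponential decay in the l1 norm. A coordinate then has total weight at most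
  \<open>1 + 3 / \<theta>\<close>, so the count is exponential with a rate that vanishes as \<theta>
  grows for fixed \<open>c\<close>.\<close>

lemma card_sparse_points_le:
  assumes c: "0 < c" and \<theta>: "1 \<le> \<theta>"
  shows "real (card (sparse_points n \<theta> c)) \<le> exp (n * ((1 / c + 4) / \<theta>))"
proof -
  define N where "N = nat \<lceil>n / c\<^sup>2\<rceil>"
  define h where "h k = exp (- (if k = 0 then 0 else ln \<theta>) - \<bar>real_of_int k\<bar>)" for k :: int
  \<comment> \<open>The first term bounds the l1 norm, by Cauchy-Schwarz over at most
    \<open>n / \<theta>\<^sup>2\<close> nonzero coordinates; the second is the cost
    \<open>ln \<theta>\<close> of each of them.\<close>
  define a where "a = n / (c * \<theta>) + n / \<theta>\<^sup>2 * ln \<theta>"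
  have eq: "sparse_points n \<theta> c = {z \<in> PiE {..<n} (\<lambda>_. {- int N..int N}). (\<Sum>j<n. (real_of_int (z j))\<^sup>2) \<le> n / c\<^sup>2 \<and>
    real (card {j. j < n \<and> z j \<noteq> 0}) \<le> n / \<theta>\<^sup>2 \<and> n / (4 * c\<^sup>2) \<le> (\<Sum>j<n. (real_of_int (z j))\<^sup>2)}"
    unfolding sparse_points_def int_ball_def N_def by auto
  have "real (card (sparse_points n \<theta> c)) \<le> exp a * (\<Prod>j<n. 1 + 3 / \<theta>)"
    unfolding eq
  proof (rule card_lattice_le)
    fix j :: nat
    have "(\<Sum>k\<in>{- int N..int N}. h k) \<le> (\<Sum>k\<in>{- int N..int N}. of_bool (k = 0) + 1 / \<theta> * exp (- 1 * \<bar>real_of_int k\<bar>))"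
    proof (rule sum_mono)
      fix k
      have "h k \<le> 1 / \<theta> * exp (- 1 * \<bar>real_of_int k\<bar>)" if "k \<noteq> 0"
        using that \<theta> by (simp add: h_def exp_diff exp_minus field_simps)
      then show "h k \<le> of_bool (k = 0) + 1 / \<theta> * exp (- 1 * \<bar>real_of_int k\<bar>)"
        using \<theta> by (cases "k = 0") (auto simp: h_def)
    qed
    also have "\<dots> = 1 + 1 / \<theta> * (\<Sum>k\<in>{- int N..int N}. exp (- 1 * \<bar>real_of_int k\<bar>))"
      unfolding sum.distrib sum_distrib_left by (simp add: of_bool_def)
    also have "\<dots> \<le> 1 + 1 / \<theta> * (1 + 2 / 1)"
      using \<theta> by (intro add_left_mono mult_left_mono sum_exp_abs_int_le) auto
    finally show "(\<Sum>k\<in>{- int N..int N}. h k) \<le> 1 + 3 / \<theta>" by simp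
  next
    fix z assume z: "(\<Sum>j<n. (real_of_int (z j))\<^sup>2) \<le> n / c\<^sup>2 \<and>
      real (card {j. j < n \<and> z j \<noteq> 0}) \<le> n / \<theta>\<^sup>2 \<and> n / (4 * c\<^sup>2) \<le> (\<Sum>j<n. (real_of_int (z j))\<^sup>2)"
    define S where "S = {j. j < n \<and> z j \<noteq> 0}"
    have S: "S \<subseteq> {..<n}" by (auto simp: S_def)
    have "(\<Sum>j<n. \<bar>real_of_int (z j)\<bar>) = (\<Sum>j\<in>S. \<bar>real_of_int (z j)\<bar>)"
      by (rule sum.mono_neutral_right) (auto simp: S_def)
    also have "\<dots> \<le> sqrt (n / \<theta>\<^sup>2 * (n / c\<^sup>2))"
    proof (rule sum_abs_le_sqrt_card)
      have "(\<Sum>j\<in>S. (real_of_int (z j))\<^sup>2) \<le> (\<Sum>j<n. (real_of_int (z j))\<^sup>2)" using S by (intro sum_mono2) auto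
      then show "(\<Sum>j\<in>S. (real_of_int (z j))\<^sup>2) \<le> n / c\<^sup>2" using z by simp
      show "finite S" using S finite_subset by auto
    qed (use z in \<open>auto simp: S_def\<close>)
    also have "\<dots> = n / (c * \<theta>)" using c \<theta> by (simp add: real_sqrt_mult real_sqrt_divide)
    finally have l1: "(\<Sum>j<n. \<bar>real_of_int (z j)\<bar>) \<le> n / (c * \<theta>)" .
    have "(\<Sum>j<n. (if z j = 0 then 0 else ln \<theta>)) = (\<Sum>j\<in>S. ln \<theta>)"
      by (rule sum.mono_neutral_cong_right) (auto simp: S_def)
    also have "\<dots> = real (card S) * ln \<theta>" by simp
    also have "\<dots> \<le> n / \<theta>\<^sup>2 * ln \<theta>" using z \<theta> by (intro mult_right_mono) (auto simp: S_def)
    finally have l0: "(\<Sum>j<n. (if z j = 0 then 0 else ln \<theta>)) \<le> n / \<theta>\<^sup>2 * ln \<theta>" .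
    have "exp a * (\<Prod>j<n. h (z j)) = exp (a + (\<Sum>j<n. - (if z j = 0 then 0 else ln \<theta>) - \<bar>real_of_int (z j)\<bar>))"
      unfolding h_def by (simp only: exp_add exp_sum finite_lessThan)
    also have "a + (\<Sum>j<n. - (if z j = 0 then 0 else ln \<theta>) - \<bar>real_of_int (z j)\<bar>)
      = a - (\<Sum>j<n. (if z j = 0 then 0 else ln \<theta>)) - (\<Sum>j<n. \<bar>real_of_int (z j)\<bar>)"
      by (simp only: sum_subtractf sum_negf)
    finally show "1 \<le> exp a * (\<Prod>j<n. h (z j))" using l0 l1 by (simp add: a_def)
  qed (auto simp: h_def)
  also have "\<dots> \<le> exp a * exp (3 / \<theta>) ^ n"
    using exp_ge_add_one_self[of "3 / \<theta>"] \<theta> by (auto intro!: mult_left_mono power_mono)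
  also have "\<dots> = exp (a + n * (3 / \<theta>))" by (simp add: exp_of_nat_mult[symmetric] exp_add)
  also have "a + n * (3 / \<theta>) \<le> n * ((1 / c + 4) / \<theta>)"
  proof -
    have "ln \<theta> \<le> \<theta>" using ln_le_minus_one[of \<theta>] \<theta> by simp
    then have "ln \<theta> / \<theta>\<^sup>2 \<le> 1 / \<theta>" using \<theta> by (simp add: field_simps power2_eq_square)
    then have "n * (ln \<theta> / \<theta>\<^sup>2) \<le> n * (1 / \<theta>)" by (rule mult_left_mono) simp
    moreover have eq1: "a + n * (3 / \<theta>) = n * (1 / c / \<theta>) + n * (ln \<theta> / \<theta>\<^sup>2) + n * (3 / \<theta>)"
      by (simp add: a_def)
    moreover have "(1 / c + 4) / \<theta> = 1 / c / \<theta> + 1 / \<theta> + 3 / \<theta>"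
      using c \<theta> by (simp add: field_simps)
    then have eq2: "n * ((1 / c + 4) / \<theta>) = n * (1 / c / \<theta>) + n * (1 / \<theta>) + n * (3 / \<theta>)"
      by (simp only: distrib_left)
    ultimately show ?thesis
      unfolding eq1 eq2 by (simp only: add_le_cancel_right add_le_cancel_left)
  qed
  finally show ?thesis by simp
qed

lemma finite_sparse_points: "finite (sparse_points n \<theta> c)"
  unfolding sparse_points_def by (rule finite_subset[OF _ finite_int_ball]) auto

text \<open>Exponents per unit of \<open>n\<close>: at least half of the rows give -\<gamma>/2, the
  Markov factor costs \<gamma>/4 and the number of points \<gamma>/8, so -\<gamma>/8
  remains.\<close>

lemma sparse_points_tail:
  fixes p \<beta> \<theta> \<rho> \<gamma> :: real
  assumes n: "0 < n" and \<beta>: "0 < \<beta>" and \<theta>: "2 \<le> \<theta>" and \<gamma>: "0 < \<gamma>"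
    and G: "\<And>(Q::nat set) u y. finite Q \<Longrightarrow> (\<forall>j\<in>Q. \<bar>u j\<bar> \<le> 1) \<Longrightarrow> 1 / 4 \<le> (\<Sum>j\<in>Q. (u j)\<^sup>2) \<Longrightarrow>
      measure_pmf.expectation (Pi_pmf Q False (\<lambda>_. bernoulli_pmf p))
      (\<lambda>x. exp (- ((\<Sum>j\<in>Q. of_bool (x j) * u j) - y)\<^sup>2 / 2)) \<le> exp (- \<gamma>)"
    and \<rho>: "\<rho>\<^sup>2 \<le> \<gamma> / 2" and \<theta>2: "(1 / \<beta> + 4) / \<theta> \<le> \<gamma> / 8"
  shows "measure_pmf.prob (edge_pmf n p)
      {X. \<exists>z\<in>sparse_points n \<theta> \<beta>. small_residual (noise p X) n \<beta> \<rho> {j. j < n \<and> z j \<noteq> 0} z}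
    \<le> (2 * real n / \<beta> + 3) * exp (- \<gamma> / 8 * n)"
proof -
  have "measure_pmf.prob (edge_pmf n p)
      {X. \<exists>z\<in>sparse_points n \<theta> \<beta>. small_residual (noise p X) n \<beta> \<rho> {j. j < n \<and> z j \<noteq> 0} z}
    \<le> exp (n * ((1 / \<beta> + 4) / \<theta>)) * ((2 * real n / \<beta> + 3) * exp (- \<gamma> / 4 * n))"
  proof (rule prob_union_le[OF finite_sparse_points card_sparse_points_le])
    fix z assume z: "z \<in> sparse_points n \<theta> \<beta>"
    define Q where "Q = {j. j < n \<and> z j \<noteq> 0}"
    have Q: "Q \<subseteq> {..<n}" by (auto simp: Q_def)
    then have fin: "finite Q" using finite_subset by auto
    have zz: "(\<Sum>j<n. (real_of_int (z j))\<^sup>2) \<le> n / \<beta>\<^sup>2" "real (card Q) \<le> n / \<theta>\<^sup>2" "n / (4 * \<beta>\<^sup>2) \<le> (\<Sum>j<n. (real_of_int (z j))\<^sup>2)"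
      using z by (auto simp: sparse_points_def int_ball_def Q_def)
    have "(\<Sum>j<n. (real_of_int (z j))\<^sup>2) = (\<Sum>j\<in>Q. (real_of_int (z j))\<^sup>2)"
      by (rule sum.mono_neutral_right) (auto simp: Q_def)
    note zQ = zz(1,3)[unfolded this]
    define u where "u j = \<beta> / sqrt (real n) * real_of_int (z j)" for j
    have usq: "(u j)\<^sup>2 = \<beta>\<^sup>2 / n * (real_of_int (z j))\<^sup>2" for j
      using n by (simp add: u_def power_mult_distrib power_divide)
    then have sumu: "(\<Sum>j\<in>Q. (u j)\<^sup>2) = \<beta>\<^sup>2 / n * (\<Sum>j\<in>Q. (real_of_int (z j))\<^sup>2)"
      by (simp add: sum_distrib_left)
    have "\<beta>\<^sup>2 / n * (n / (4 * \<beta>\<^sup>2)) \<le> (\<Sum>j\<in>Q. (u j)\<^sup>2)"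
      unfolding sumu using zQ by (intro mult_left_mono) auto
    then have ge: "1 / 4 \<le> (\<Sum>j\<in>Q. (u j)\<^sup>2)" using \<beta> n by simp
    have le1: "\<bar>u j\<bar> \<le> 1" if "j \<in> Q" for j
    proof -
      have "(u j)\<^sup>2 \<le> (\<Sum>j\<in>Q. (u j)\<^sup>2)" using that fin by (intro member_le_sum) auto
      also have "\<dots> \<le> \<beta>\<^sup>2 / n * (n / \<beta>\<^sup>2)" unfolding sumu using zQ by (intro mult_left_mono) auto
      also have "\<dots> = 1" using \<beta> n by simp
      finally show ?thesis by (simp add: abs_square_le_1)
    qed
    have "measure_pmf.prob (edge_pmf n p) {X. small_residual (noise p X) n \<beta> \<rho> Q z}
      \<le> (2 * real n / \<beta> + 3) * (exp (\<rho>\<^sup>2 * real n / (2 * 1\<^sup>2)) * exp (- \<gamma>) ^ card ({..<n} - Q))"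
    proof (rule small_residual_tail[OF \<beta> Q])
      show "measure_pmf.expectation (Pi_pmf Q False (\<lambda>_. bernoulli_pmf p))
        (\<lambda>x. exp (- ((\<Sum>j\<in>Q. of_bool (x j) * (\<beta> / sqrt (real n) * real_of_int (z j))) - y)\<^sup>2 / (2 * 1\<^sup>2))) \<le> exp (- \<gamma>)" for y
        using G[OF fin _ ge, of y] le1 unfolding u_def by simp
    qed auto
    also have "\<dots> \<le> (2 * real n / \<beta> + 3) * exp (- \<gamma> / 4 * n)"
    proof (rule mult_left_mono)
      note zz(2)
      also have "n / \<theta>\<^sup>2 \<le> n / 2\<^sup>2" using \<theta> by (intro divide_left_mono power_mono) auto
      also have "\<dots> = n / 4" by simp
      finally have "real (card Q) \<le> n / 4" .
      moreover have "card ({..<n} - Q) = n - card Q" using Q fin by (simp add: card_Diff_subset)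
      moreover have "card Q \<le> n" using card_mono[OF _ Q] by simp
      ultimately have "real n / 2 \<le> real (card ({..<n} - Q))" by (simp add: of_nat_diff)
      then have "\<gamma> * (n / 2) \<le> \<gamma> * real (card ({..<n} - Q))" using \<gamma> by (intro mult_left_mono) auto
      moreover have "\<rho>\<^sup>2 * n \<le> \<gamma> / 2 * n" using \<rho> by (rule mult_right_mono) simp
      ultimately have "\<rho>\<^sup>2 * real n / 2 + real (card ({..<n} - Q)) * - \<gamma> \<le> - \<gamma> / 4 * n" by (simp add: mult.commute)
      then show "exp (\<rho>\<^sup>2 * real n / (2 * 1\<^sup>2)) * exp (- \<gamma>) ^ card ({..<n} - Q) \<le> exp (- \<gamma> / 4 * n)"
        unfolding exp_of_nat_mult[symmetric] mult_exp_exp by simp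
    qed (use \<beta> in auto)
    finally show "measure_pmf.prob (edge_pmf n p) {X. small_residual (noise p X) n \<beta> \<rho> {j. j < n \<and> z j \<noteq> 0} z}
      \<le> (2 * real n / \<beta> + 3) * exp (- \<gamma> / 4 * n)" by (simp add: Q_def)
  qed (use \<beta> \<theta> n in auto)
  also have "\<dots> = (2 * real n / \<beta> + 3) * exp (n * ((1 / \<beta> + 4) / \<theta>) + - \<gamma> / 4 * n)"
    by (simp only: exp_add mult_ac)
  also have "\<dots> \<le> (2 * real n / \<beta> + 3) * exp (- \<gamma> / 8 * n)"
    using mult_left_mono[OF \<theta>2, of n] \<beta> by (intro mult_left_mono) (auto simp: algebra_simps)
  finally show ?thesis .
qed

text \<open>By Cauchy-Schwarz the l1 norm is at most \<open>n / c\<close>. The weight parameter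
  \<open>c\<close> turns this into the factor \<open>exp n\<close>, and each coordinate costs
  \<open>1 + 2 / c \<le> 3 / c\<close>.\<close>

lemma card_spread_points_le:
  assumes c: "0 < c" "c \<le> 1" and Q: "Q \<subseteq> {..<n}"
  shows "real (card (spread_points n \<theta> \<beta> c Q)) \<le> exp n * 3 ^ n * (1 / c) ^ card Q"
proof -
  define N where "N = nat \<lceil>n / c\<^sup>2\<rceil>"
  have fin: "finite Q" and cardQ: "card Q \<le> n" using Q finite_subset card_mono[of "{..<n}" Q] by auto
  have eq: "spread_points n \<theta> \<beta> c Q = {z \<in> PiE Q (\<lambda>_. {- int N..int N}). (\<Sum>j\<in>Q. (real_of_int (z j))\<^sup>2) \<le> n / c\<^sup>2 \<and>
    \<beta>\<^sup>2 * real n / (4 * c\<^sup>2) \<le> (\<Sum>j\<in>{j\<in>Q. \<bar>real_of_int (z j)\<bar> \<le> \<theta> / c}. (real_of_int (z j))\<^sup>2)}"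
    unfolding spread_points_def int_ball_def N_def by auto
  have "real (card (spread_points n \<theta> \<beta> c Q)) \<le> exp (c * (n / c)) * (1 + 2 / c) ^ card Q"
    unfolding eq
  proof (rule card_lattice_l1_le[OF fin c(1)])
    fix z assume "(\<Sum>j\<in>Q. (real_of_int (z j))\<^sup>2) \<le> n / c\<^sup>2 \<and>
      \<beta>\<^sup>2 * real n / (4 * c\<^sup>2) \<le> (\<Sum>j\<in>{j\<in>Q. \<bar>real_of_int (z j)\<bar> \<le> \<theta> / c}. (real_of_int (z j))\<^sup>2)"
    then have "(\<Sum>j\<in>Q. \<bar>real_of_int (z j)\<bar>) \<le> sqrt (n * (n / c\<^sup>2))"
      using fin cardQ by (intro sum_abs_le_sqrt_card) auto
    also have "\<dots> = n / c" using c by (simp add: real_sqrt_mult real_sqrt_divide)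
    finally show "(\<Sum>j\<in>Q. \<bar>real_of_int (z j)\<bar>) \<le> n / c" .
  qed
  also have "\<dots> \<le> exp n * (3 * (1 / c)) ^ card Q"
    using c by (intro mult_mono power_mono) (auto simp: field_simps)
  also have "\<dots> = exp n * 3 ^ card Q * (1 / c) ^ card Q" by (simp only: power_mult_distrib mult_ac)
  also have "\<dots> \<le> exp n * 3 ^ n * (1 / c) ^ card Q"
    using cardQ c by (intro mult_right_mono mult_left_mono power_increasing) auto
  finally show ?thesis .
qed

lemma finite_spread_points: "finite Q \<Longrightarrow> finite (spread_points n \<theta> \<beta> c Q)"
  unfolding spread_points_def by (rule finite_subset[OF _ finite_int_ball]) auto

text \<open>A coordinate in \<open>Q\<close> costs a factor of order \<open>1 / c\<close> and a row
  outside \<open>Q\<close> gains one of order \<open>c\<close>. The balance is positive exactly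
  because \<open>Q\<close> is smaller than its complement. The constant collects 2 for the sets
  \<open>Q\<close>, 3 and \<open>exp 1\<close> for the points, and \<open>exp (1 / 2)\<close> from
  Markov's inequality at scale \<rho>.\<close>

lemma spread_points_tail:
  fixes p \<beta> \<theta> c \<rho> D \<eta> :: real
  assumes p: "0 < p" "p < 1" and \<beta>: "0 < \<beta>" and \<theta>: "0 < \<theta>" and c: "0 < c" "c \<le> 1" and \<rho>: "0 < \<rho>" and D: "1 \<le> D"
    and n: "0 < n" "\<theta>\<^sup>2 / \<rho> ^ 3 \<le> n" and D\<rho>: "\<rho> * (1 / sqrt (p * (1 - p) / 2 * (\<beta>\<^sup>2 / 4)) + 1) \<le> c * D"
  shows "measure_pmf.prob (edge_pmf n p)
      {X. \<exists>Q\<in>{Q. Q \<subseteq> {..<n} \<and> real (card Q) \<le> (1 / 2 - \<eta>) * n}. \<exists>z\<in>spread_points n \<theta> \<beta> c Q. small_residual (noise p X) n c \<rho> Q z}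
    \<le> (2 * real n / c + 3) * (6 * exp (3 / 2) * D * c powr (2 * \<eta>)) ^ n"
proof -
  define e where "e = (2 * real n / c + 3) * (3 * exp (3 / 2) * D * c powr (2 * \<eta>)) ^ n"
  have "measure_pmf.prob (edge_pmf n p)
      {X. \<exists>Q\<in>{Q. Q \<subseteq> {..<n} \<and> real (card Q) \<le> (1 / 2 - \<eta>) * n}. \<exists>z\<in>spread_points n \<theta> \<beta> c Q. small_residual (noise p X) n c \<rho> Q z}
    \<le> 2 ^ n * e"
  proof (rule prob_union_le)
    have "card {Q. Q \<subseteq> {..<n} \<and> real (card Q) \<le> (1 / 2 - \<eta>) * n} \<le> card (Pow {..<n})"
      by (rule card_mono) auto
    then show "real (card {Q. Q \<subseteq> {..<n} \<and> real (card Q) \<le> (1 / 2 - \<eta>) * n}) \<le> 2 ^ n"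
      by (simp add: card_Pow)
    show "finite {Q. Q \<subseteq> {..<n} \<and> real (card Q) \<le> (1 / 2 - \<eta>) * n}"
      by (rule finite_subset[of _ "Pow {..<n}"]) auto
    show "0 \<le> e" unfolding e_def using c D by simp
    fix Q assume "Q \<in> {Q. Q \<subseteq> {..<n} \<and> real (card Q) \<le> (1 / 2 - \<eta>) * n}"
    then have Q: "Q \<subseteq> {..<n}" and cardQ: "real (card Q) \<le> (1 / 2 - \<eta>) * n" by auto
    have fin: "finite Q" using Q finite_subset by auto
    define R where "R = card ({..<n} - Q)"
    have R: "R = n - card Q" "card Q \<le> n" unfolding R_def using Q fin card_mono[of "{..<n}" Q] by (auto simp: card_Diff_subset)
    have "measure_pmf.prob (edge_pmf n p) {X. \<exists>z\<in>spread_points n \<theta> \<beta> c Q. small_residual (noise p X) n c \<rho> Q z}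
      \<le> (exp n * 3 ^ n * (1 / c) ^ card Q) * ((2 * real n / c + 3) * (exp (\<rho>\<^sup>2 * real n / (2 * \<rho>\<^sup>2)) * (c * D) ^ R))"
    proof (rule prob_union_le[OF finite_spread_points[OF fin] card_spread_points_le[OF c Q]])
      fix z assume z: "z \<in> spread_points n \<theta> \<beta> c Q"
      define J where "J = {j\<in>Q. \<bar>real_of_int (z j)\<bar> \<le> \<theta> / c}"
      define u where "u j = c / sqrt (real n) * real_of_int (z j)" for j
      have "(\<Sum>j\<in>J. (u j)\<^sup>2) = c\<^sup>2 / n * (\<Sum>j\<in>J. (real_of_int (z j))\<^sup>2)"
        using n by (simp add: u_def power_mult_distrib power_divide sum_distrib_left)
      also have "\<dots> \<ge> c\<^sup>2 / n * (\<beta>\<^sup>2 * real n / (4 * c\<^sup>2))"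
        using z unfolding spread_points_def J_def by (intro mult_left_mono) auto
      finally have V: "\<beta>\<^sup>2 / 4 \<le> (\<Sum>j\<in>J. (u j)\<^sup>2)" using n c by simp
      have uJ: "\<bar>u j\<bar> \<le> \<theta> / sqrt (real n)" if "j \<in> J" for j
      proof -
        have "c / sqrt (real n) * \<bar>real_of_int (z j)\<bar> \<le> c / sqrt (real n) * (\<theta> / c)"
          using that c n by (intro mult_left_mono) (auto simp: J_def)
        then show ?thesis using c n by (simp add: u_def abs_mult)
      qed
      show "measure_pmf.prob (edge_pmf n p) {X. small_residual (noise p X) n c \<rho> Q z}
        \<le> (2 * real n / c + 3) * (exp (\<rho>\<^sup>2 * real n / (2 * \<rho>\<^sup>2)) * (c * D) ^ R)"
        unfolding R_def
      proof (rule small_residual_tail[OF c(1) Q \<rho>])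
        fix y
        have "measure_pmf.expectation (Pi_pmf Q False (\<lambda>_. bernoulli_pmf p))
          (\<lambda>x. exp (- ((\<Sum>j\<in>Q. of_bool (x j) * u j) - y)\<^sup>2 / (2 * \<rho>\<^sup>2)))
          \<le> \<rho> / sqrt (p * (1 - p) / 2 * (\<beta>\<^sup>2 / 4)) + (\<theta> / sqrt (real n))\<^sup>2 / \<rho>\<^sup>2"
          by (rule gaussian_concentration_spread[OF p fin \<rho> _ _ _ uJ V]) (use \<theta> n \<beta> in \<open>auto simp: J_def\<close>)
        \<comment> \<open>The Chebyshev error has order \<open>1 / n\<close>, so for large
          \<open>n\<close> it is below the main term of order \<rho>.\<close>
        also have "(\<theta> / sqrt (real n))\<^sup>2 / \<rho>\<^sup>2 \<le> \<rho>"
        proof -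
          have "\<theta>\<^sup>2 \<le> n * \<rho> ^ 3" using n \<rho> by (simp add: pos_divide_le_eq)
          then show ?thesis using n \<rho> by (simp add: power_divide field_simps power3_eq_cube power2_eq_square)
        qed
        also have "\<rho> / sqrt (p * (1 - p) / 2 * (\<beta>\<^sup>2 / 4)) + \<rho> \<le> c * D" using D\<rho> by (simp add: distrib_left)
        finally show "measure_pmf.expectation (Pi_pmf Q False (\<lambda>_. bernoulli_pmf p))
          (\<lambda>x. exp (- ((\<Sum>j\<in>Q. of_bool (x j) * (c / sqrt (real n) * real_of_int (z j))) - y)\<^sup>2 / (2 * \<rho>\<^sup>2))) \<le> c * D"
          unfolding u_def by simp
      qed (use c D in auto)
    qed (use c D in auto)
    also have "\<dots> \<le> e"
    proof -
      \<comment> \<open>The power of \<open>c\<close> is \<open>n - 2 * card Q\<close>, which is at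
        least \<open>2 * \<eta> * n\<close>; as \<open>c \<le> 1\<close>, this bounds the
        product.\<close>
      have "(1 / c) ^ card Q * (c * D) ^ R \<le> (D * c powr (2 * \<eta>)) ^ n"
      proof -
        have "(1 / c) ^ card Q * (c * D) ^ R = c powr (real R - real (card Q)) * D ^ R"
          using c by (simp add: power_mult_distrib powr_diff powr_realpow power_divide)
        also have "\<dots> \<le> c powr (2 * \<eta> * n) * D ^ n"
        proof (intro mult_mono power_increasing)
          have "real R = real n - real (card Q)" using R by (simp add: of_nat_diff)
          then have le: "2 * \<eta> * n \<le> real R - real (card Q)" using cardQ by (simp add: algebra_simps)
          show "c powr (real R - real (card Q)) \<le> c powr (2 * \<eta> * n)"
            using c le by (intro powr_mono') auto
        qed (use c D R in auto)
        also have "c powr (2 * \<eta> * n) = (c powr (2 * \<eta>)) ^ n"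
          using c by (simp add: powr_realpow[symmetric] powr_powr)
        finally show ?thesis by (simp add: power_mult_distrib mult.commute)
      qed
      then have le: "(2 * real n / c + 3) * (3 * exp (3 / 2)) ^ n * ((1 / c) ^ card Q * (c * D) ^ R)
        \<le> (2 * real n / c + 3) * (3 * exp (3 / 2)) ^ n * (D * c powr (2 * \<eta>)) ^ n"
        using c by (intro mult_left_mono) auto
      have half: "\<rho>\<^sup>2 * n / (2 * \<rho>\<^sup>2) = n / 2" using \<rho> by simp
      have "exp (3 / 2) ^ n = exp (real n) * exp (n / 2)"
        unfolding exp_of_nat_mult[symmetric] mult_exp_exp by (simp add: field_simps)
      then have "(exp n * 3 ^ n * (1 / c) ^ card Q) * ((2 * real n / c + 3) * (exp (\<rho>\<^sup>2 * n / (2 * \<rho>\<^sup>2)) * (c * D) ^ R))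
        = (2 * real n / c + 3) * (3 * exp (3 / 2)) ^ n * ((1 / c) ^ card Q * (c * D) ^ R)"
        unfolding half power_mult_distrib[of 3] by (simp only: mult_ac)
      also note le
      also have "(2 * real n / c + 3) * (3 * exp (3 / 2)) ^ n * (D * c powr (2 * \<eta>)) ^ n = e"
        unfolding e_def by (simp only: power_mult_distrib mult.assoc)
      finally show ?thesis .
    qed
    finally show "measure_pmf.prob (edge_pmf n p) {X. \<exists>z\<in>spread_points n \<theta> \<beta> c Q. small_residual (noise p X) n c \<rho> Q z} \<le> e" .
  qed
  also have "2 ^ n * e = (2 * real n / c + 3) * (6 * exp (3 / 2) * D * c powr (2 * \<eta>)) ^ n"
  proof -
    have "(6::real) ^ n = 2 ^ n * 3 ^ n" by (simp add: power_mult_distrib[symmetric])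
    then show ?thesis unfolding e_def power_mult_distrib by (simp only: mult_ac)
  qed
  finally show ?thesis .
qed

section \<open>Choice of constants and assembly of the three bad events\<close>

theorem theorem6:
  fixes p \<eta> :: real
  assumes "0 < p" "p < 1" and "0 < \<eta>"
  shows "\<exists>C::real. C > 0 \<and> (\<lambda>n. measure_pmf.prob (gnp n p)
           {G. \<forall>v \<mu>. eigenvector (adjacency_matrix n G) v \<mu> \<and> L2_set (vec_index v) {..<n} = 1 \<longrightarrow>
                 (1 / 2 - \<eta>) * real n
                   \<le> real (card {i. i < n \<and> 1 / (sqrt (real n) * ln (real n) powr C) \<le> \<bar>vec_index v i\<bar>})})
         \<longlonglongrightarrow> 1"
proof -
  have p: "0 \<le> p" "p \<le> 1" using assms by auto
  have "0 < (1 / 4 :: real)" by simp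
  from gaussian_concentration_sparse[where 'a = nat, OF assms(1,2) this]
  obtain G :: real where G: "0 < G" "G < 1"
    and sparse: "\<forall>(Q::nat set) (u::nat \<Rightarrow> real) y. finite Q \<longrightarrow> (\<forall>j\<in>Q. \<bar>u j\<bar> \<le> 1) \<longrightarrow> 1 / 4 \<le> (\<Sum>j\<in>Q. (u j)\<^sup>2)
      \<longrightarrow> measure_pmf.expectation (Pi_pmf Q False (\<lambda>_. bernoulli_pmf p))
        (\<lambda>x. exp (- ((\<Sum>j\<in>Q. of_bool (x j) * u j) - y)\<^sup>2 / 2)) \<le> G"
    by blast
  define \<gamma> where "\<gamma> = - ln G"
  have \<gamma>: "0 < \<gamma>" "exp (- \<gamma>) = G" using G by (auto simp: \<gamma>_def)
  \<comment> \<open>880 = 11 * 80, where 80 is the norm constant and 11 comes from the residual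
    bound. The constants \<gamma>, \<beta>, \<theta>, \<open>D\<close> are fixed in this order from
    \<open>p\<close> alone; \<eta> enters only in \<open>c\<close>.\<close>
  define \<beta> where "\<beta> = min (1 / 4) (sqrt (\<gamma> / 2) / 880)"
  have \<beta>: "0 < \<beta>" "\<beta> \<le> 1 / 4" "880 * \<beta> \<le> sqrt (\<gamma> / 2)" using \<gamma> by (auto simp: \<beta>_def min_def)
  then have \<rho>: "(880 * \<beta>)\<^sup>2 \<le> \<gamma> / 2"
    using power_mono[of "880 * \<beta>" "sqrt (\<gamma> / 2)" 2] \<gamma> by simp
  define \<theta> where "\<theta> = max 2 ((1 / \<beta> + 4) / (\<gamma> / 8))"
  have \<theta>: "2 \<le> \<theta>" "(1 / \<beta> + 4) / (\<gamma> / 8) \<le> \<theta>" by (auto simp: \<theta>_def)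
  then have \<theta>': "(1 / \<beta> + 4) / \<theta> \<le> \<gamma> / 8" using \<gamma> by (simp add: field_simps)
  \<comment> \<open>Chosen so that for \<rho> = \<open>880 * c\<close> the small-ball bound of a row
    is exactly \<open>c * D\<close>, whatever \<open>c\<close> is.\<close>
  define D where "D = 880 * (1 / sqrt (p * (1 - p) / 2 * (\<beta>\<^sup>2 / 4)) + 1)"
  have D: "1 \<le> D" unfolding D_def using assms \<beta> by (simp add: add_increasing)
  define E where "E = 6 * exp (3 / 2) * D"
  have E: "0 < E" using D by (simp add: E_def)
  \<comment> \<open>The second entry of the minimum makes the base of the exponential in the spread
    case at most 1/2.\<close>
  define c where "c = min (\<beta> / 4) ((1 / (2 * E)) powr (1 / (2 * \<eta>)))"
  have c: "0 < c" "c \<le> \<beta> / 4" "c \<le> (1 / (2 * E)) powr (1 / (2 * \<eta>))" using \<beta> E by (auto simp: c_def)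
  have Ec: "E * c powr (2 * \<eta>) \<le> 1 / 2"
  proof -
    have "c powr (2 * \<eta>) \<le> ((1 / (2 * E)) powr (1 / (2 * \<eta>))) powr (2 * \<eta>)"
      using c assms by (intro powr_mono2) auto
    also have "\<dots> = 1 / (2 * E)" using assms E by (simp add: powr_powr)
    finally have "E * c powr (2 * \<eta>) \<le> E * (1 / (2 * E))" using E by (intro mult_left_mono) auto
    then show ?thesis using E by simp
  qed
  \<comment> \<open>The exponent 1 of the logarithm suffices: the argument works at the threshold
    \<open>c / sqrt n\<close>, and \<open>1 / ln n\<close> falls below the constant
    \<open>c\<close>.\<close>
  define good where "good n = {G. \<forall>v \<mu>. eigenvector (adjacency_matrix n G) v \<mu> \<and> L2_set (vec_index v) {..<n} = 1 \<longrightarrow>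
                 (1 / 2 - \<eta>) * real n
                   \<le> real (card {i. i < n \<and> 1 / (sqrt (real n) * ln (real n) powr 1) \<le> \<bar>vec_index v i\<bar>})}" for n
  define B where "B n = exp (- real n) + (2 * real n / \<beta> + 3) * exp (- \<gamma> / 8 * real n) + (2 * real n / c + 3) * (1 / 2) ^ n" for n
  have lower: "1 - B n \<le> measure_pmf.prob (gnp n p) (good n)"
    if n: "1 < n" "exp (1 / c) \<le> real n" "\<theta>\<^sup>2 / (880 * c) ^ 3 \<le> real n" for n
  proof -
    define B1 where "B1 = {X. \<exists>z\<in>int_ball {..<n} (4 * n) (4 * real n). \<exists>w\<in>int_ball {..<n} (4 * n) (4 * real n).
      80 * (real n * sqrt (real n)) < (\<Sum>i<n. \<Sum>j<n. noise p X i j * real_of_int (z i) * real_of_int (w j))}"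
    define B2 where "B2 = {X. \<exists>z\<in>sparse_points n \<theta> \<beta>. small_residual (noise p X) n \<beta> (880 * \<beta>) {j. j < n \<and> z j \<noteq> 0} z}"
    define B3 where "B3 = {X. \<exists>Q\<in>{Q. Q \<subseteq> {..<n} \<and> real (card Q) \<le> (1 / 2 - \<eta>) * n}. \<exists>z\<in>spread_points n \<theta> \<beta> c Q.
      small_residual (noise p X) n c (880 * c) Q z}"
    have b1: "measure_pmf.prob (edge_pmf n p) B1 \<le> exp (- real n)"
      unfolding B1_def by (rule noise_lattice_norm_tail[OF p]) (use n in auto)
    have b2: "measure_pmf.prob (edge_pmf n p) B2 \<le> (2 * real n / \<beta> + 3) * exp (- \<gamma> / 8 * real n)"
      unfolding B2_def
    proof (rule sparse_points_tail[OF _ \<beta>(1) \<theta>(1) \<gamma>(1) _ \<rho> \<theta>'])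
      show "measure_pmf.expectation (Pi_pmf Q False (\<lambda>_. bernoulli_pmf p))
        (\<lambda>x. exp (- ((\<Sum>j\<in>Q. of_bool (x j) * u j) - y)\<^sup>2 / 2)) \<le> exp (- \<gamma>)"
        if "finite Q" "\<forall>j\<in>Q. \<bar>u j\<bar> \<le> 1" "1 / 4 \<le> (\<Sum>j\<in>Q. (u j)\<^sup>2)" for Q :: "nat set" and u y
        unfolding \<gamma>(2) using sparse that by blast
    qed (use n in simp)
    have "measure_pmf.prob (edge_pmf n p) B3 \<le> (2 * real n / c + 3) * (6 * exp (3 / 2) * D * c powr (2 * \<eta>)) ^ n"
      unfolding B3_def
      by (rule spread_points_tail[OF assms(1,2) \<beta>(1) _ c(1) _ _ D _ n(3)]) (use \<theta> c \<beta> n in \<open>auto simp: D_def\<close>)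
    also have "\<dots> \<le> (2 * real n / c + 3) * (1 / 2) ^ n"
      using Ec E c by (intro mult_left_mono power_mono) (auto simp: E_def)
    finally have b3: "measure_pmf.prob (edge_pmf n p) B3 \<le> (2 * real n / c + 3) * (1 / 2) ^ n" .
    define f where "f X = {e \<in> all_edges n. X e}" for X
    \<comment> \<open>The implication is deterministic. All eigenvectors are handled at once because
      the three events refer to finitely many lattice points only.\<close>
    have bad: "X \<in> B1 \<union> B2 \<union> B3" if notgood: "f X \<notin> good n" for X
    proof (rule ccontr)
      assume notB: "X \<notin> B1 \<union> B2 \<union> B3"
      define \<tau> where "\<tau> = 1 / (sqrt (real n) * ln (real n) powr 1)"
      obtain v \<mu> where ev: "eigenvector (adjacency_matrix n (f X)) v \<mu>" and unit: "L2_set (vec_index v) {..<n} = 1"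
        and few: "real (card {i. i < n \<and> \<tau> \<le> \<bar>vec_index v i\<bar>}) < (1 / 2 - \<eta>) * real n"
        using notgood unfolding good_def \<tau>_def by (auto simp: not_le)
      define m where "m = noise p X"
      have "1 / c \<le> ln (real n)" using n c by (subst ln_ge_iff) auto
      then have "1 / ln (real n) \<le> c" using c n by (simp add: field_simps)
      then have \<tau>: "0 \<le> \<tau>" "\<tau> * sqrt (real n) \<le> c" using n by (auto simp: \<tau>_def)
      have norm: "L2_set (\<lambda>i. \<Sum>j<n. m i j * x j) {..<n} \<le> 80 * sqrt (real n) * L2_set x {..<n}" for x
        by (rule matrix_norm_le_if_int_ball) (use n notB in \<open>auto simp: B1_def m_def not_less\<close>)
      \<comment> \<open>The all-ones part of the mean sends \<open>v\<close> to a multiple of the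
        constant vector, so it enters the equation only through this scalar.\<close>
      define b where "b = - p * (\<Sum>j<n. vec_index v j)"
      have "\<bar>\<Sum>j<n. vec_index v j\<bar> \<le> (\<Sum>j<n. \<bar>vec_index v j\<bar>)" by (rule sum_abs)
      also have "\<dots> \<le> sqrt (real n * 1)"
        using unit L2_set_power2[of "vec_index v" "{..<n}"] by (intro sum_abs_le_sqrt_card) auto
      also have "\<dots> \<le> sqrt (real n * real n)" using n by (intro real_sqrt_le_mono mult_left_mono) auto
      finally have "\<bar>\<Sum>j<n. vec_index v j\<bar> \<le> n" by simp
      then have "p * \<bar>\<Sum>j<n. vec_index v j\<bar> \<le> 1 * real n" using p by (intro mult_mono) auto
      then have b: "\<bar>b\<bar> \<le> n" using p by (simp add: b_def abs_mult)
      have dim: "v \<in> carrier_vec n" and mult: "adjacency_matrix n (f X) *\<^sub>v v = \<mu> \<cdot>\<^sub>v v"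
        using ev by (auto simp: eigenvector_def adjacency_matrix_def)
      \<comment> \<open>The noise is the adjacency matrix minus \<open>p\<close> times the all-ones
        matrix plus \<open>p\<close> times the identity; the last part shifts the eigenvalue to
        \<open>\<mu> + p\<close>.\<close>
      have eq: "(\<Sum>j<n. m i j * vec_index v j) = (\<mu> + p) * vec_index v i + b" if i: "i < n" for i
      proof -
        have entry: "m i j = adjacency_matrix n (f X) $$ (i, j) - p + (if i = j then p else 0)" if "j < n" for j
          using that i pair_in_all_edges[of i n j]
          by (auto simp: m_def noise_def adjacency_matrix_def f_def all_edges_def)
        have "\<mu> * vec_index v i = vec_index (adjacency_matrix n (f X) *\<^sub>v v) i"
          using mult dim i by simp
        also have "\<dots> = (\<Sum>j<n. adjacency_matrix n (f X) $$ (i, j) * vec_index v j)"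
          using dim i by (simp add: adjacency_matrix_def scalar_prod_def lessThan_atLeast0)
        finally have \<mu>: "\<mu> * vec_index v i = (\<Sum>j<n. adjacency_matrix n (f X) $$ (i, j) * vec_index v j)" .
        have "(\<Sum>j<n. m i j * vec_index v j) = (\<Sum>j<n. adjacency_matrix n (f X) $$ (i, j) * vec_index v j - p * vec_index v j + (if i = j then p * vec_index v j else 0))"
          by (intro sum.cong refl) (auto simp: entry algebra_simps)
        also have "\<dots> = \<mu> * vec_index v i + b + p * vec_index v i"
          using i by (simp add: sum.distrib sum_subtractf \<mu> b_def sum_distrib_left sum_negf)
        finally show ?thesis by (simp add: distrib_right)
      qed
      define T where "T = {i. i < n \<and> \<tau> \<le> \<bar>vec_index v i\<bar>}"
      have "real n / 2 \<le> real (card T)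
        \<or> (\<exists>z\<in>sparse_points n \<theta> \<beta>. small_residual m n \<beta> (11 * 80 * \<beta>) {j. j < n \<and> z j \<noteq> 0} z)
        \<or> (\<exists>z\<in>spread_points n \<theta> \<beta> c T. small_residual m n c (11 * 80 * c) T z)"
        unfolding T_def
        by (rule eigenvector_large_entries_or_small_residual[OF _ _ b norm unit eq \<beta>(1,2) _ c(1,2) \<tau>]) (use n \<theta> in auto)
      moreover have "\<not> real n / 2 \<le> real (card T)"
      proof -
        have "(1 / 2 - \<eta>) * real n \<le> real n / 2" using assms by (simp add: left_diff_distrib)
        then show ?thesis using few by (simp add: T_def)
      qed
      moreover have "\<not> (\<exists>z\<in>sparse_points n \<theta> \<beta>. small_residual m n \<beta> (11 * 80 * \<beta>) {j. j < n \<and> z j \<noteq> 0} z)"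
        using notB by (simp add: B2_def m_def)
      moreover have "T \<in> {Q. Q \<subseteq> {..<n} \<and> real (card Q) \<le> (1 / 2 - \<eta>) * n}"
        using few by (auto simp: T_def)
      then have "\<not> (\<exists>z\<in>spread_points n \<theta> \<beta> c T. small_residual m n c (11 * 80 * c) T z)"
        using notB unfolding B3_def m_def by auto
      ultimately show False by blast
    qed
    have "1 - measure_pmf.prob (gnp n p) (good n) = measure_pmf.prob (gnp n p) (- good n)"
      using measure_pmf.prob_compl[of "good n" "gnp n p"] by (simp add: Compl_eq_Diff_UNIV)
    also have "\<dots> = measure_pmf.prob (edge_pmf n p) (f -` (- good n))"
      unfolding gnp_def f_def[abs_def] by simp
    also have "\<dots> \<le> measure_pmf.prob (edge_pmf n p) (B1 \<union> B2 \<union> B3)"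
      using bad by (intro measure_pmf.finite_measure_mono) auto
    also have "\<dots> \<le> measure_pmf.prob (edge_pmf n p) B1 + measure_pmf.prob (edge_pmf n p) B2 + measure_pmf.prob (edge_pmf n p) B3"
      by (intro order_trans[OF measure_Un_le] add_mono measure_Un_le) auto
    also have "\<dots> \<le> B n" using b1 b2 b3 by (simp add: B_def)
    finally show ?thesis by simp
  qed
  have "(\<lambda>n. measure_pmf.prob (gnp n p) (good n)) \<longlonglongrightarrow> 1"
  proof (rule tendsto_sandwich)
    have "(\<lambda>n. exp (- real n)) \<longlonglongrightarrow> 0" by real_asymp
    moreover have "(\<lambda>n. (2 * real n / \<beta> + 3) * exp (- \<gamma> / 8 * real n)) \<longlonglongrightarrow> 0"
      using \<beta>(1) \<gamma>(1) by real_asymp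
    moreover have "(\<lambda>n. (2 * real n / c + 3) * (1 / 2) ^ n) \<longlonglongrightarrow> 0"
      using c(1) by real_asymp
    ultimately have "B \<longlonglongrightarrow> 0" unfolding B_def by (intro tendsto_add_zero)
    then show "(\<lambda>n. 1 - B n) \<longlonglongrightarrow> 1" using tendsto_diff[OF tendsto_const, of B 0 sequentially 1] by simp
    have "eventually (\<lambda>n. 1 < n) sequentially" "eventually (\<lambda>n. exp (1 / c) \<le> real n) sequentially"
      "eventually (\<lambda>n. \<theta>\<^sup>2 / (880 * c) ^ 3 \<le> real n) sequentially"
      by (rule eventually_gt_at_top, (rule filterlim_at_top[THEN iffD1, rule_format], rule filterlim_real_sequentially)+)
    then show "eventually (\<lambda>n. 1 - B n \<le> measure_pmf.prob (gnp n p) (good n)) sequentially"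
      by eventually_elim (rule lower)
  qed auto
  then show ?thesis unfolding good_def by (intro exI[of _ 1]) simp
qed

end
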